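(* Let $\mathcal{A}$ be a unital $C^*$-algebra over $\mathbb{F}$, where $\mathbb{F}=\mathbb{R}$ or $\mathbb{C}$. Let $a\in\mathcal{A}$ and let $\mathcal{B}$ be a subspace of $\mathcal{A}$. Then there exist a cyclic representation $(\mathcal{H},\pi,\xi)$ of $\mathcal{A}$ and a unit vector $\eta\in\mathcal{H}$ such that $\mathrm{dist}(a,\mathcal{B})=\langle\eta|\pi(a)\xi\rangle$ and $\langle\eta|\pi(b)\xi\rangle=0$ for all $b\in\mathcal{B}$.
   Context: "Subspace" means $\mathbb{F}$-linear subspace (not assumed closed). $\mathrm{dist}(a,\mathcal{B})=\inf\{\|a-b\|: b\in\mathcal{B}\}$. A cyclic representation $(\mathcal{H},\pi,\xi)$ of $\mathcal{A}$ consists of a Hilbert space $\mathcal{H}$ over $\mathbb{F}$, a $*$-algebra map $\pi:\mathcal{A}\to\mathscr{B}(\mathcal{H})$ with $\pi(1_{\mathcal{A}})=I$, and a vector $\xi\in\mathcal{H}$ with $\|\xi\|=1$ such that the closure of $\{\pi(c)\xi: c\in\mathcal{A}\}$ is $\mathcal{H}$. Here $\mathscr{B}(\mathcal{H})$ is the $C^*$-algebra of bounded $\mathbb{F}$-linear operators on $\mathcal{H}$, $I$ is its identity and $1_{\mathcal{A}}$ is the identity of $\mathcal{A}$. Inner products $\langle\cdot|\cdot\rangle$ are conjugate linear in the first coordinate and linear in the second.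
   Formalization: The subspace B is additionally assumed not to be dense in A; for dense B (e.g. B = A = F) the claim is false, since a unit vector η cannot be orthogonal to all π(b)ξ, b ∈ B, which are then dense in H. *)

theory Defs
  imports "HOL-Analysis.Analysis" "HOL-Library.Function_Algebras"
begin

text \<open>
  The scalar field is a set \<open>F\<close> of complex numbers that is either \<open>\<real>\<close> or the whole of
  \<open>\<complex>\<close>, so that both cases share one set of definitions. A scalar multiplication is a function
  \<open>complex \<Rightarrow> 'v \<Rightarrow> 'v\<close> of which only the values at scalars in \<open>F\<close> matter; likewise only its
  values on the carrier matter.
\<close>

definition subspace_over ::
    "complex set \<Rightarrow> (complex \<Rightarrow> 'v \<Rightarrow> 'v) \<Rightarrow> 'v::ab_group_add set \<Rightarrow> bool" where
  "subspace_over F scl V \<longleftrightarrow>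
     0 \<in> V \<and> (\<forall>x\<in>V. \<forall>y\<in>V. x + y \<in> V) \<and> (\<forall>c\<in>F. \<forall>x\<in>V. scl c x \<in> V)"

locale vector_space_over =
  fixes F :: "complex set"
    and V :: "'v::ab_group_add set"
    and scl :: "complex \<Rightarrow> 'v \<Rightarrow> 'v"
  assumes scalars: "F = \<real> \<or> F = UNIV"
    and carrier_closed: "subspace_over F scl V"
    and scale_add_right: "\<And>c x y. c \<in> F \<Longrightarrow> x \<in> V \<Longrightarrow> y \<in> V \<Longrightarrow> scl c (x + y) = scl c x + scl c y"
    and scale_add_left: "\<And>c d x. c \<in> F \<Longrightarrow> d \<in> F \<Longrightarrow> x \<in> V \<Longrightarrow> scl (c + d) x = scl c x + scl d x"
    and scale_scale: "\<And>c d x. c \<in> F \<Longrightarrow> d \<in> F \<Longrightarrow> x \<in> V \<Longrightarrow> scl c (scl d x) = scl (c * d) x"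
    and scale_one: "\<And>x. x \<in> V \<Longrightarrow> scl 1 x = x"
begin

lemma real_in_scalars: "complex_of_real r \<in> F"
  using scalars by auto

lemma zero_mem: "0 \<in> V"
  and add_mem: "x \<in> V \<Longrightarrow> y \<in> V \<Longrightarrow> x + y \<in> V"
  and scale_mem: "c \<in> F \<Longrightarrow> x \<in> V \<Longrightarrow> scl c x \<in> V"
  using carrier_closed unfolding subspace_over_def by auto

lemma scale_zero_left: "x \<in> V \<Longrightarrow> scl 0 x = 0"
  using scale_add_left[of 0 0 x] real_in_scalars[of 0] by simp

lemma scale_minus_one: assumes "x \<in> V" shows "scl (-1) x = - x"
proof -
  have "scl (1 + -1) x = scl 1 x + scl (-1) x"
    using scale_add_left[of 1 "-1" x] real_in_scalars[of 1] real_in_scalars[of "-1"] assms by simp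
  then show ?thesis
    using scale_zero_left[OF assms] scale_one[OF assms] by (simp add: eq_neg_iff_add_eq_0 add.commute)
qed

lemma minus_mem: "x \<in> V \<Longrightarrow> - x \<in> V"
  using scale_mem[of "-1" x] scale_minus_one[of x] real_in_scalars[of "-1"] by simp

lemma diff_mem: "x \<in> V \<Longrightarrow> y \<in> V \<Longrightarrow> x - y \<in> V"
  using add_mem[of x "- y"] minus_mem[of y] by simp

end

text \<open>
  The underlying real Banach algebra structure, including \<open>norm 1 = 1\<close>, is that of the type
  classes, and the scalar multiplication by \<open>F\<close> extends the one by real numbers. For \<open>F = \<real>\<close>
  the \<open>C\<^sup>*\<close>-identity alone does not characterise \<open>C\<^sup>*\<close>-algebras (it holds for
  \<open>\<complex>\<close> as a real algebra with the trivial involution), and the standard definition of a real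
  \<open>C\<^sup>*\<close>-algebra demands in addition that every \<open>1 + x\<^sup>* x\<close> be invertible.
\<close>

locale unital_cstar_algebra =
  vector_space_over F "UNIV :: 'a::{real_normed_algebra_1, banach} set" scale
  for F :: "complex set"
    and scale :: "complex \<Rightarrow> 'a::{real_normed_algebra_1, banach} \<Rightarrow> 'a" +
  fixes star :: "'a \<Rightarrow> 'a"
  assumes scale_of_real: "\<And>r x. scale (complex_of_real r) x = r *\<^sub>R x"
    and norm_scale: "\<And>c x. c \<in> F \<Longrightarrow> norm (scale c x) = cmod c * norm x"
    and scale_mult_left: "\<And>c x y. c \<in> F \<Longrightarrow> scale c x * y = scale c (x * y)"
    and scale_mult_right: "\<And>c x y. c \<in> F \<Longrightarrow> x * scale c y = scale c (x * y)"
    and star_star: "\<And>x. star (star x) = x"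
    and star_add: "\<And>x y. star (x + y) = star x + star y"
    and star_scale: "\<And>c x. c \<in> F \<Longrightarrow> star (scale c x) = scale (cnj c) (star x)"
    and star_mult: "\<And>x y. star (x * y) = star y * star x"
    and cstar_identity: "\<And>x. norm (star x * x) = (norm x)\<^sup>2"
    and real_invertible:
      "F = \<real> \<Longrightarrow> \<exists>y. (1 + star x * x) * y = 1 \<and> y * (1 + star x * x) = 1"

text \<open>Inner products are linear in the second argument and take values in \<open>F\<close>.\<close>

locale inner_product_space =
  vector_space_over F H scl
  for F :: "complex set" and H :: "'h::ab_group_add set" and scl :: "complex \<Rightarrow> 'h \<Rightarrow> 'h" +
  fixes ip :: "'h \<Rightarrow> 'h \<Rightarrow> complex"
  assumes ip_scalar: "\<And>g h. g \<in> H \<Longrightarrow> h \<in> H \<Longrightarrow> ip g h \<in> F"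
    and ip_add_right: "\<And>g h k. g \<in> H \<Longrightarrow> h \<in> H \<Longrightarrow> k \<in> H \<Longrightarrow> ip g (h + k) = ip g h + ip g k"
    and ip_scale_right: "\<And>c g h. c \<in> F \<Longrightarrow> g \<in> H \<Longrightarrow> h \<in> H \<Longrightarrow> ip g (scl c h) = c * ip g h"
    and ip_cnj: "\<And>g h. g \<in> H \<Longrightarrow> h \<in> H \<Longrightarrow> ip h g = cnj (ip g h)"
    and ip_pos: "\<And>h. h \<in> H \<Longrightarrow> h \<noteq> 0 \<Longrightarrow> 0 < Re (ip h h)"
begin

definition hnorm :: "'h \<Rightarrow> real" where
  "hnorm h = sqrt (Re (ip h h))"

text \<open>The value outside the carrier is only there because \<^locale>\<open>Metric_space\<close> asks for
  nonnegativity and symmetry on the whole type.\<close>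

definition hdist :: "'h \<Rightarrow> 'h \<Rightarrow> real" where
  "hdist g h = (if g \<in> H \<and> h \<in> H then hnorm (g - h) else 0)"

lemma ip_zero_right: "g \<in> H \<Longrightarrow> ip g 0 = 0"
  using ip_add_right[of g 0 0] zero_mem by simp

lemma ip_add_left: "g \<in> H \<Longrightarrow> h \<in> H \<Longrightarrow> k \<in> H \<Longrightarrow> ip (g + h) k = ip g k + ip h k"
  using ip_cnj[of k "g + h"] ip_cnj[of k g] ip_cnj[of k h] ip_add_right[of k g h] add_mem by simp

lemma ip_minus_right: assumes "g \<in> H" "h \<in> H" shows "ip g (- h) = - ip g h"
  using ip_scale_right[of "-1" g h] scale_minus_one[of h] real_in_scalars[of "-1"] assms by simp

lemma ip_minus_left: "g \<in> H \<Longrightarrow> h \<in> H \<Longrightarrow> ip (- g) h = - ip g h"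
  using ip_cnj[of h "- g"] ip_cnj[of h g] ip_minus_right[of h g] minus_mem by simp

lemma ip_self_ge_0: "h \<in> H \<Longrightarrow> 0 \<le> Re (ip h h)"
  using ip_pos[of h] ip_zero_right[OF zero_mem] by (cases "h = 0") auto

lemma hnorm_ge_0: "h \<in> H \<Longrightarrow> 0 \<le> hnorm h"
  unfolding hnorm_def using ip_self_ge_0 by simp

lemma hnorm_eq_0: "h \<in> H \<Longrightarrow> hnorm h = 0 \<longleftrightarrow> h = 0"
  unfolding hnorm_def using ip_pos[of h] ip_zero_right[OF zero_mem] by (cases "h = 0") auto

lemma hnorm_minus: "h \<in> H \<Longrightarrow> hnorm (- h) = hnorm h"
  unfolding hnorm_def using ip_minus_left[of h "- h"] ip_minus_right[of h h] minus_mem by simp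

lemma hnorm_power2: "h \<in> H \<Longrightarrow> (hnorm h)\<^sup>2 = Re (ip h h)"
  unfolding hnorm_def using ip_self_ge_0 by simp

lemma ip_Cauchy_Schwarz:
  assumes g: "g \<in> H" and h: "h \<in> H"
  shows "cmod (ip g h) \<le> hnorm g * hnorm h"
proof (cases "h = 0")
  case True
  then show ?thesis using g ip_zero_right hnorm_eq_0[OF zero_mem] by simp
next
  case False
  define z where "z = ip g h"
  define q where "q = Re (ip h h)"
  have q: "0 < q" using ip_pos[OF h False] by (simp add: q_def)
  have hh: "ip h h = complex_of_real q"
    using ip_cnj[OF h h] by (simp add: q_def complex_eq_iff)
  have hg: "ip h g = cnj z" using ip_cnj[OF g h] by (simp add: z_def)
  define c where "c = - (cnj z / complex_of_real q)"
  have zF: "z \<in> F" using ip_scalar[OF g h] by (simp add: z_def)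
  have cF: "c \<in> F"
    using scalars zF by (auto simp: c_def Reals_cnj_iff)
  define k where "k = scl c h"
  have k: "k \<in> H" using scale_mem[OF cF h] by (simp add: k_def)
  have gk: "ip g k = c * z" using ip_scale_right[OF cF g h] by (simp add: k_def z_def)
  have hk: "ip h k = c * complex_of_real q" using ip_scale_right[OF cF h h] hh by (simp add: k_def)
  have kg: "ip k g = cnj (c * z)" using ip_cnj[OF g k] gk by simp
  have kh: "ip k h = cnj (c * complex_of_real q)" using ip_cnj[OF h k] hk by simp
  have kk: "ip k k = c * cnj (c * complex_of_real q)"
    using ip_scale_right[OF cF k h] kh by (simp add: k_def)
  have "ip (g + k) (g + k) = ip g g + c * z + cnj (c * z) + c * cnj (c * complex_of_real q)"
    using ip_add_left[OF g k add_mem[OF g k]] ip_add_right[OF g g k] ip_add_right[OF k g k] gk kg kk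
    by simp
  moreover have "c * z = - complex_of_real ((cmod z)\<^sup>2 / q)"
    unfolding c_def using complex_norm_square[of z] by (simp add: mult.commute)
  moreover have "c * cnj (c * complex_of_real q) = complex_of_real ((cmod z)\<^sup>2 / q)"
    unfolding c_def using complex_norm_square[of z] q
    by (simp add: mult.commute power2_eq_square)
  ultimately have "ip (g + k) (g + k) = ip g g - complex_of_real ((cmod z)\<^sup>2 / q)" by simp
  then have "0 \<le> Re (ip g g) - (cmod z)\<^sup>2 / q"
    using ip_self_ge_0[OF add_mem[OF g k]] by simp
  then have "(cmod z)\<^sup>2 \<le> Re (ip g g) * q" using q by (simp add: field_simps)
  also have "\<dots> = (hnorm g * hnorm h)\<^sup>2"
    using hnorm_power2[OF g] hnorm_power2[OF h] by (simp add: q_def power_mult_distrib)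
  finally show ?thesis
    using power2_le_imp_le[of "cmod z" "hnorm g * hnorm h"] hnorm_ge_0[OF g] hnorm_ge_0[OF h]
    by (simp add: z_def)
qed

lemma hnorm_triangle:
  assumes g: "g \<in> H" and h: "h \<in> H"
  shows "hnorm (g + h) \<le> hnorm g + hnorm h"
proof -
  have "(hnorm (g + h))\<^sup>2 = (hnorm g)\<^sup>2 + 2 * Re (ip g h) + (hnorm h)\<^sup>2"
    using hnorm_power2[OF g] hnorm_power2[OF h] hnorm_power2[OF add_mem[OF g h]]
      ip_add_left[OF g h add_mem[OF g h]] ip_add_right[OF g g h] ip_add_right[OF h g h]
      ip_cnj[OF g h] by simp
  also have "\<dots> \<le> (hnorm g + hnorm h)\<^sup>2"
    using ip_Cauchy_Schwarz[OF g h] complex_Re_le_cmod[of "ip g h"]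
    by (simp add: power2_sum)
  finally show ?thesis
    using power2_le_imp_le hnorm_ge_0[OF g] hnorm_ge_0[OF h] by fastforce
qed

sublocale Metric_space H hdist
proof
  fix x y
  show "0 \<le> hdist x y"
    using hnorm_ge_0 diff_mem by (simp add: hdist_def)
  show "hdist x y = hdist y x"
    using hnorm_minus[of "x - y"] diff_mem by (simp add: hdist_def)
next
  fix x y assume "x \<in> H" "y \<in> H"
  then show "hdist x y = 0 \<longleftrightarrow> x = y"
    using hnorm_eq_0[of "x - y"] diff_mem by (simp add: hdist_def)
next
  fix x y z assume "x \<in> H" "y \<in> H" "z \<in> H"
  then show "hdist x z \<le> hdist x y + hdist y z"
    using hnorm_triangle[of "x - y" "y - z"] diff_mem by (simp add: hdist_def)
qed

end

locale hilbert_space = inner_product_space F H scl ip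
  for F :: "complex set"
    and H :: "'h::ab_group_add set"
    and scl :: "complex \<Rightarrow> 'h \<Rightarrow> 'h"
    and ip :: "'h \<Rightarrow> 'h \<Rightarrow> complex" +
  assumes complete: mcomplete
begin

text \<open>Operators are functions on the ambient type, of which only the restriction to the
  carrier matters.\<close>

definition bounded_operator :: "('h \<Rightarrow> 'h) \<Rightarrow> bool" where
  "bounded_operator T \<longleftrightarrow>
     (\<forall>h\<in>H. T h \<in> H) \<and>
     (\<forall>g\<in>H. \<forall>h\<in>H. T (g + h) = T g + T h) \<and>
     (\<forall>c\<in>F. \<forall>h\<in>H. T (scl c h) = scl c (T h)) \<and>
     (\<exists>K. \<forall>h\<in>H. hnorm (T h) \<le> K * hnorm h)"

end

text \<open>In \<open>rep_star\<close> the operator adjoint is expressed by its defining property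
  \<open>\<langle>T\<^sup>* g | h\<rangle> = \<langle>g | T h\<rangle>\<close>.

  HOL cannot quantify existentially over the type \<open>'h\<close>. Taking \<open>'h\<close> to be
  \<open>'a \<Rightarrow> complex\<close> loses no generality: since \<open>\<pi>(\<A>)\<xi>\<close> is dense, sending \<open>h\<close>
  to the function \<open>c \<mapsto> \<langle>\<pi>(c)\<xi> | h\<rangle>\<close> is an injective linear map, so every cyclic
  representation is isomorphic to one whose carrier is a subspace of that type.\<close>

locale cyclic_representation =
  unital_cstar_algebra F scale star + hilbert_space F H scl ip
  for F :: "complex set"
    and scale :: "complex \<Rightarrow> 'a::{real_normed_algebra_1, banach} \<Rightarrow> 'a"
    and star :: "'a \<Rightarrow> 'a"
    and H :: "'h::ab_group_add set"
    and scl :: "complex \<Rightarrow> 'h \<Rightarrow> 'h"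
    and ip :: "'h \<Rightarrow> 'h \<Rightarrow> complex" +
  fixes rep :: "'a \<Rightarrow> 'h \<Rightarrow> 'h"
    and \<xi> :: 'h
  assumes rep_bounded: "\<And>x. bounded_operator (rep x)"
    and rep_add: "\<And>x y h. h \<in> H \<Longrightarrow> rep (x + y) h = rep x h + rep y h"
    and rep_scale: "\<And>c x h. c \<in> F \<Longrightarrow> h \<in> H \<Longrightarrow> rep (scale c x) h = scl c (rep x h)"
    and rep_mult: "\<And>x y h. h \<in> H \<Longrightarrow> rep (x * y) h = rep x (rep y h)"
    and rep_star: "\<And>x g h. g \<in> H \<Longrightarrow> h \<in> H \<Longrightarrow> ip (rep (star x) g) h = ip g (rep x h)"
    and rep_one: "\<And>h. h \<in> H \<Longrightarrow> rep 1 h = h"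
    and cyclic_mem: "\<xi> \<in> H"
    and cyclic_unit: "hnorm \<xi> = 1"
    and cyclic_dense: "mtopology closure_of (range (\<lambda>x. rep x \<xi>)) = H"

text \<open>
  A unit vector of \<open>H\<close> cannot be orthogonal to all of \<open>\<pi>(\<A>)\<xi>\<close>, nor (by continuity of
  \<open>\<pi>\<close>) to \<open>\<pi>(\<B>)\<xi>\<close> for a dense subspace \<open>\<B>\<close> of the algebra. This is why the theorem
  has to exclude subspaces that are dense.
\<close>

lemma (in cyclic_representation) unit_vector_not_orthogonal_to_orbit:
  assumes "\<eta> \<in> H" and "hnorm \<eta> = 1"
  shows "\<exists>x. ip \<eta> (rep x \<xi>) \<noteq> 0"
proof (rule ccontr)
  assume "\<not> ?thesis"
  then have orth: "ip \<eta> (rep x \<xi>) = 0" for x by blast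
  have "\<eta> \<in> mtopology closure_of (range (\<lambda>x. rep x \<xi>))"
    using assms(1) cyclic_dense by simp
  then obtain x where x: "rep x \<xi> \<in> mball \<eta> 1"
    unfolding metric_closure_of by force
  let ?d = "\<eta> - rep x \<xi>"
  have mem: "rep x \<xi> \<in> H" and lt: "hnorm ?d < 1"
    using x assms(1) by (auto simp: in_mball hdist_def)
  have "ip \<eta> \<eta> = ip \<eta> ?d + ip \<eta> (rep x \<xi>)"
    using ip_add_right[of \<eta> ?d "rep x \<xi>"] assms(1) mem diff_mem by simp
  then have "Re (ip \<eta> ?d) = 1"
    using orth hnorm_power2[OF assms(1)] assms(2) by simp
  then have "1 \<le> cmod (ip \<eta> ?d)"
    using complex_Re_le_cmod[of "ip \<eta> ?d"] by simp
  also have "\<dots> \<le> hnorm ?d"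
    using ip_Cauchy_Schwarz[of \<eta> ?d] assms mem diff_mem by simp
  finally show False using lt by simp
qed

end

theory Submission
  imports Defs
begin

text \<open>
  By Hahn--Banach there is a functional \<open>\<psi>\<close> of norm \<open>1\<close> that vanishes on \<open>B\<close> and takes the value
  \<open>dist(a, B)\<close> at \<open>a\<close>. A second application of Hahn--Banach yields a state \<open>\<phi>\<close> with
  \<open>\<bar>\<psi>(x)\<bar>\<^sup>2 \<le> \<phi>(x\<^sup>* x)\<close>, so \<open>\<psi>\<close> is a contractive functional on \<open>\<pi>(A)\<xi>\<close> in the GNS
  representation of \<open>\<phi>\<close>, hence \<open>\<psi>(x) = \<langle>\<eta>|\<pi>(x)\<xi>\<rangle>\<close>, and \<open>\<parallel>\<psi>\<parallel> = 1\<close> forces \<open>\<parallel>\<eta>\<parallel> = 1\<close>. The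
  existence of \<open>\<phi>\<close> rests on the order structure of a \<open>C\<^sup>*\<close>-algebra, which is obtained for real
  and complex scalars alike from the fact that \<open>\<parallel>k\<parallel>\<close> or \<open>-\<parallel>k\<parallel>\<close> lies in the spectrum of a
  self-adjoint \<open>k\<close>.
\<close>

section \<open>Invertible elements and the spectral radius\<close>

text \<open>The shape of the proof is dictated by treating real and complex scalars at once:
  holomorphic resolvents and a continuous functional calculus are avoided. Positivity is a norm
  inequality, square roots come from a binomial series, and a single fact about self-adjoint norms
  ties positivity to invertibility. The state is chosen to pin the norm of \<eta> from both sides.
  Domination of \<psi> by the GNS seminorm gives at most 1. Since \<phi>(1) = 1, the GNS seminorm is
  at most the norm of the algebra, so a functional of norm 1 there cannot become smaller on the GNS
  space. Such a \<phi> exists for convexity reasons: the infinitely many constraints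
  \<phi>(\<open>star w * w\<close>) \<ge> 1, one for each w with \<psi>(w) = 1, can be imposed
  together because the elements \<open>star w * w\<close> form a convex set up to adding positive
  elements. Hahn-Banach is used only for real-linear functionals; those with values in
  \<open>F\<close> are rebuilt from their real parts.\<close>

definition unit_elem :: "'a::monoid_mult \<Rightarrow> bool" where
  "unit_elem x \<longleftrightarrow> (\<exists>y. x * y = 1 \<and> y * x = 1)"

definition unit_inv :: "'a::monoid_mult \<Rightarrow> 'a" where
  "unit_inv x = (SOME y. x * y = 1 \<and> y * x = 1)"

lemma unit_inv:
  assumes "unit_elem x"
  shows "x * unit_inv x = 1" "unit_inv x * x = 1"
  using someI_ex[of "\<lambda>y. x * y = 1 \<and> y * x = 1"] assms
  unfolding unit_elem_def unit_inv_def by auto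

lemma one_sided_inverses_eq:
  fixes x :: "'a::monoid_mult"
  assumes "z * x = 1" "x * y = 1" shows "z = y"
  by (metis assms mult.assoc mult_1_left mult_1_right)

lemma unit_elemI:
  fixes x :: "'a::monoid_mult"
  assumes "z * x = 1" "x * y = 1" shows "unit_elem x"
  using one_sided_inverses_eq[OF assms] assms unfolding unit_elem_def by auto

lemma unit_inv_eqI:
  fixes x :: "'a::monoid_mult"
  assumes "z * x = 1" "x * y = 1" shows "unit_inv x = y"
  using one_sided_inverses_eq[OF unit_inv(2) assms(2)] unit_elemI[OF assms] by simp

lemma unit_elem_mult:
  fixes x y :: "'a::monoid_mult"
  assumes "unit_elem x" "unit_elem y" shows "unit_elem (x * y)"
proof (rule unit_elemI)
  show "(unit_inv y * unit_inv x) * (x * y) = 1"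
    by (metis assms mult.assoc mult_1_left unit_inv(2))
  show "(x * y) * (unit_inv y * unit_inv x) = 1"
    by (metis assms mult.assoc mult_1_left unit_inv(1))
qed

text \<open>The inverse of the product supplies both one-sided inverses of \<open>x\<close>;
  commutation moves \<open>y\<close> to the side needed for the left one. It serves to recover
  \<open>1 - x\<close> from its square.\<close>

lemma unit_elem_commuting_factor:
  fixes x y :: "'a::monoid_mult"
  assumes "x * y = y * x" "unit_elem (x * y)" shows "unit_elem x"
proof (rule unit_elemI)
  show "(unit_inv (x * y) * y) * x = 1"
    by (metis assms mult.assoc unit_inv(2))
  show "x * (y * unit_inv (x * y)) = 1"
    by (metis assms(2) mult.assoc unit_inv(1))
qed

lemma unit_inv_commute:
  fixes x a :: "'a::monoid_mult"
  assumes "unit_elem x" "a * x = x * a" shows "a * unit_inv x = unit_inv x * a"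
  by (metis assms mult.assoc mult_1_left mult_1_right unit_inv)

lemma unit_elem_scaleR:
  fixes x :: "'a::real_algebra_1"
  assumes "unit_elem x" "c \<noteq> 0" shows "unit_elem (c *\<^sub>R x)"
  by (rule unit_elemI[of "inverse c *\<^sub>R unit_inv x" _ "inverse c *\<^sub>R unit_inv x"])
    (use assms in \<open>auto simp: unit_inv\<close>)

lemma unit_elem_scaleR_iff:
  fixes x :: "'a::real_algebra_1"
  assumes "c \<noteq> 0" shows "unit_elem (c *\<^sub>R x) \<longleftrightarrow> unit_elem x"
  using unit_elem_scaleR[of x c] unit_elem_scaleR[of "c *\<^sub>R x" "inverse c"] assms by auto

section \<open>Neumann series and continuity of inversion\<close>

lemma summable_power_banach:
  fixes x :: "'a::{real_normed_algebra_1, banach}"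
  assumes "norm x < 1" shows "summable (\<lambda>n. x ^ n)"
proof (rule summable_comparison_test)
  show "\<exists>N. \<forall>n\<ge>N. norm (x ^ n) \<le> norm x ^ n" by (simp add: norm_power_ineq)
  show "summable (\<lambda>n. norm x ^ n)" using assms by (intro summable_geometric) simp
qed

lemma unit_elem_one_minus:
  fixes x :: "'a::{real_normed_algebra_1, banach}"
  assumes "norm x < 1" shows "unit_elem (1 - x)"
proof (rule unit_elemI)
  let ?s = "\<Sum>n. x ^ n"
  note S = summable_power_banach[OF assms]
  have "x * ?s = (\<Sum>n. x ^ Suc n)" using suminf_mult[OF S, of x] by simp
  also have "\<dots> = ?s - 1" using suminf_split_head[OF S] by simp
  finally show "(1 - x) * ?s = 1" by (simp add: algebra_simps)
  have "?s * x = (\<Sum>n. x ^ Suc n)"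
    using suminf_mult2[OF S, of x] by (simp only: power_Suc2)
  also have "\<dots> = ?s - 1" using suminf_split_head[OF S] by simp
  finally show "?s * (1 - x) = 1" by (simp add: algebra_simps)
qed

text \<open>Dividing by \<open>t\<close> reduces this to the Neumann series. The closed version of
  this ball is the one that later defines positivity.\<close>

lemma unit_elem_near_scalar:
  fixes x :: "'a::{real_normed_algebra_1, banach}"
  assumes "norm (t *\<^sub>R 1 - x) < t" shows "unit_elem x"
proof -
  have t: "t > 0" using assms norm_ge_zero[of "t *\<^sub>R 1 - x"] by linarith
  have "norm (1 - inverse t *\<^sub>R x) = norm (inverse t *\<^sub>R (t *\<^sub>R 1 - x))"
    using t by (simp add: algebra_simps)
  also have "\<dots> < 1" unfolding norm_scaleR using assms t by (simp add: field_simps)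
  finally have "unit_elem (1 - (1 - inverse t *\<^sub>R x))" by (rule unit_elem_one_minus)
  then show ?thesis using t unit_elem_scaleR_iff[of "inverse t" x] by simp
qed

lemma isCont_unit_inv:
  fixes x :: "'a::{real_normed_algebra_1, banach}"
  assumes x: "unit_elem x" shows "isCont unit_inv x"
proof -
  define y where "y = unit_inv x"
  have xy: "x * y = 1" "y * x = 1" using unit_inv[OF x] by (auto simp: y_def)
  have bound: "norm (unit_inv x' - y) \<le> 2 * (norm y)\<^sup>2 * norm (x - x')"
    if x': "norm (x - x') * norm y \<le> 1/2" for x'
  proof -
    have "norm (y * (x - x')) \<le> 1/2"
      using norm_mult_ineq[of y "x - x'"] x' by (simp add: mult.commute)
    then have "unit_elem (1 - y * (x - x'))" by (intro unit_elem_one_minus) simp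
    then have "unit_elem (x * (1 - y * (x - x')))" by (rule unit_elem_mult[OF x])
    moreover have "x * (1 - y * (x - x')) = x'"
      using xy by (simp add: algebra_simps flip: mult.assoc)
    ultimately have ux: "unit_elem x'" by simp
    define z where "z = unit_inv x'"
    have z: "z * x' = 1" using unit_inv[OF ux] by (simp add: z_def)
    \<comment> \<open>Resolvent identity. The factor 1/2 in the smallness condition lets
      \<open>norm z\<close> be absorbed on the left, which bounds it by
      \<open>2 * norm y\<close>.\<close>
    have eq: "z - y = z * (x - x') * y"
      using xy z by (simp add: algebra_simps)
    have n1: "norm (z - y) \<le> norm z * (norm (x - x') * norm y)"
      unfolding eq mult.assoc
      by (intro order.trans[OF norm_mult_ineq] mult_left_mono norm_mult_ineq) auto
    also have "\<dots> \<le> norm z * (1/2)" using x' by (intro mult_left_mono) auto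
    finally have "norm z \<le> 2 * norm y" using norm_triangle_ineq2[of z y] by simp
    then have "norm z * (norm (x - x') * norm y) \<le> 2 * norm y * (norm (x - x') * norm y)"
      by (intro mult_right_mono) auto
    then show ?thesis using n1 by (simp add: z_def power2_eq_square algebra_simps)
  qed
  have "(\<lambda>x'. norm (x - x') * norm y) \<midarrow>x\<rightarrow> norm (x - x) * norm y" by (intro tendsto_intros)
  then have "\<forall>\<^sub>F x' in at x. norm (x - x') * norm y < 1/2"
    by (rule order_tendstoD) simp
  then have "\<forall>\<^sub>F x' in at x. norm (unit_inv x' - y) \<le> 2 * (norm y)\<^sup>2 * norm (x - x')"
    by eventually_elim (use bound in auto)
  moreover have "(\<lambda>x'. 2 * (norm y)\<^sup>2 * norm (x - x')) \<midarrow>x\<rightarrow> 2 * (norm y)\<^sup>2 * norm (x - x)"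
    by (intro tendsto_intros)
  ultimately have "(\<lambda>x'. unit_inv x' - y) \<midarrow>x\<rightarrow> 0"
    by (auto intro: Lim_null_comparison)
  then show ?thesis unfolding isCont_def y_def[symmetric] by (rule LIM_zero_cancel)
qed

lemma continuous_on_unit_inv:
  fixes f :: "'b::topological_space \<Rightarrow> 'a::{real_normed_algebra_1, banach}"
  assumes "continuous_on S f" "\<And>x. x \<in> S \<Longrightarrow> unit_elem (f x)"
  shows "continuous_on S (\<lambda>x. unit_inv (f x))"
proof -
  have "continuous_on (f ` S) unit_inv"
    using assms(2) by (intro continuous_at_imp_continuous_on) (auto intro: isCont_unit_inv)
  then show ?thesis by (rule continuous_on_compose2[OF _ assms(1)]) auto
qed

text \<open>With c = cos \<theta> this is the product of 1 - z x and 1 - z' x for the conjugate pair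
  z, z' = e^(i \<theta>), e^(-i \<theta>), multiplied out so that only real coefficients
  occur.\<close>

definition quad :: "real \<Rightarrow> 'a::real_algebra_1 \<Rightarrow> 'a" where
  "quad c x = 1 - (2 * c) *\<^sub>R x + x * x"

text \<open>For real scalars \<open>x\<close> and \<open>c = cos \<theta>\<close> this is the real part of \<open>1 / (1 - e\<^sup>i\<^sup>\<theta> x)\<close>.\<close>

definition resolvent_part :: "real \<Rightarrow> 'a::real_algebra_1 \<Rightarrow> 'a" where
  "resolvent_part c x = (1 - c *\<^sub>R x) * unit_inv (quad c x)"

text \<open>Double angle: replacing \<open>c\<close> by \<open>- c\<close> turns z = e^(i \<theta>)
  into -z, and (1 - z x)(1 + z x) = 1 - z^2 x^2.\<close>

lemma quad_mult_minus: "quad c x * quad (- c) x = quad (2 * c\<^sup>2 - 1) (x * x)"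
  unfolding quad_def by (simp add: algebra_simps scaleR_2 flip: scaleR_add_left) (simp add: power2_eq_square algebra_simps)

text \<open>Partial fractions 2/(1 - z^2 x^2) = 1/(1 - z x) + 1/(1 + z x) in real parts;
  \<open>num\<close> below is the identity of numerators.\<close>

lemma resolvent_part_square:
  fixes x :: "'a::real_algebra_1"
  assumes "unit_elem (quad c x)" "unit_elem (quad (- c) x)"
  shows "2 *\<^sub>R resolvent_part (2 * c\<^sup>2 - 1) (x * x) = resolvent_part c x + resolvent_part (- c) x"
proof -
  define P Q where "P = quad c x" and "Q = quad (- c) x"
  define p q where "p = unit_inv P" and "q = unit_inv Q"
  have comm: "P * Q = Q * P"
    unfolding P_def Q_def quad_def by (simp add: algebra_simps)
  have pq: "P * p = 1" "p * P = 1" "Q * q = 1" "q * Q = 1"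
    using assms unit_inv by (auto simp: p_def q_def P_def Q_def)
  have Qp: "Q * p = p * Q"
    using unit_inv_commute[of P Q] assms(1) comm by (simp add: p_def P_def)
  have pq': "q * p = p * q"
    using unit_inv_commute[of Q p] assms(2) Qp by (simp add: q_def Q_def)
  have "(q * p) * (P * Q) = 1" "(P * Q) * (q * p) = 1"
    by (metis mult.assoc mult_1_left pq)+
  then have "unit_inv (P * Q) = q * p" by (rule unit_inv_eqI)
  then have inv: "unit_inv (quad (2 * c\<^sup>2 - 1) (x * x)) = q * p"
    by (simp add: quad_mult_minus P_def Q_def)
  have num: "2 *\<^sub>R (1 - (2 * c\<^sup>2 - 1) *\<^sub>R (x * x)) = (1 - c *\<^sub>R x) * Q + (1 + c *\<^sub>R x) * P"
    unfolding P_def Q_def quad_def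
    by (simp add: algebra_simps power2_eq_square scaleR_2)
      (simp add: add.assoc[symmetric] flip: scaleR_add_left)
  have "2 *\<^sub>R resolvent_part (2 * c\<^sup>2 - 1) (x * x) = ((1 - c *\<^sub>R x) * Q + (1 + c *\<^sub>R x) * P) * (q * p)"
    unfolding resolvent_part_def inv num[symmetric] by simp
  also have "\<dots> = (1 - c *\<^sub>R x) * (Q * q) * p + (1 + c *\<^sub>R x) * (P * p) * q"
    by (simp only: pq' distrib_right mult.assoc flip: pq')
  also have "\<dots> = resolvent_part c x + resolvent_part (- c) x"
    unfolding pq by (simp add: resolvent_part_def p_def q_def P_def Q_def)
  finally show ?thesis .
qed

lemma quad_one: "quad 1 x = (1 - x) * (1 - x)"
  by (simp add: quad_def algebra_simps scaleR_2)

lemma resolvent_part_one: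
  assumes "unit_elem (1 - x)"
  shows "resolvent_part 1 x * (1 - x) = 1"
proof -
  let ?y = "unit_inv (1 - x)"
  have "unit_inv (quad 1 x) = ?y * ?y"
    unfolding quad_one by (rule unit_inv_eqI[of "?y * ?y"]) (metis assms unit_inv mult.assoc mult_1_left)+
  then show ?thesis
    using unit_inv[OF assms] by (simp add: resolvent_part_def) (metis mult.assoc mult_1_left)
qed

lemma continuous_on_resolvent_part:
  fixes k :: "'a::{real_normed_algebra_1, banach}"
  assumes "\<And>s c. (s, c) \<in> S \<Longrightarrow> unit_elem (quad c (s *\<^sub>R k))"
  shows "continuous_on S (\<lambda>(s, c). resolvent_part c (s *\<^sub>R k))"
proof -
  have "continuous_on S (\<lambda>p. quad (snd p) (fst p *\<^sub>R k))"
    unfolding quad_def by (intro continuous_intros)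
  then have "continuous_on S (\<lambda>p. unit_inv (quad (snd p) (fst p *\<^sub>R k)))"
    by (rule continuous_on_unit_inv) (use assms in auto)
  then show ?thesis
    unfolding resolvent_part_def case_prod_unfold by (intro continuous_intros)
qed

text \<open>As a polynomial in \<open>k\<close> this has the roots e^(i \<theta>)/s and e^(-i
  \<theta>)/s. Non-real roots are handled by \<open>spec\<close>. A real root is 1/s or -1/s: for
  \<open>s < 1\<close> it exceeds the norm of \<open>k\<close>, and for \<open>s = 1\<close> it is
  covered by \<open>units\<close>.\<close>

lemma unit_elem_quad_scaled:
  fixes k :: "'a::{real_normed_algebra_1, banach}"
  assumes norm: "norm k \<le> 1"
    and spec: "\<And>a b. b \<noteq> 0 \<Longrightarrow> unit_elem ((k - a *\<^sub>R 1) * (k - a *\<^sub>R 1) + b\<^sup>2 *\<^sub>R 1)"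
    and units: "unit_elem (1 - k)" "unit_elem (1 + k)"
    and s: "0 < s" "s \<le> 1" and c: "\<bar>c\<bar> \<le> 1"
  shows "unit_elem (quad c (s *\<^sub>R k))"
proof (cases "\<bar>c\<bar> = 1")
  case True
  have *: "unit_elem (1 - s *\<^sub>R (c *\<^sub>R k))"
  proof (cases "s = 1")
    case True
    then show ?thesis using units \<open>\<bar>c\<bar> = 1\<close> by (auto simp: abs_if split: if_splits)
  next
    case False
    then have "s < 1" using s by simp
    moreover have "s * norm k \<le> s * 1" using s norm by (intro mult_left_mono) auto
    ultimately have "s * norm k < 1" by linarith
    then show ?thesis using s True by (intro unit_elem_one_minus) (simp add: abs_mult)
  qed
  have "c * c = 1" using True by (metis abs_mult_self_eq mult_1)
  then have cc: "c * (c * r) = r" for r by (metis mult.assoc mult_1)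
  have "quad c (s *\<^sub>R k) = (1 - s *\<^sub>R (c *\<^sub>R k)) * (1 - s *\<^sub>R (c *\<^sub>R k))"
    by (simp add: quad_def algebra_simps cc)
      (simp add: add.assoc[symmetric] flip: scaleR_add_left)
  then show ?thesis using unit_elem_mult[OF * *] by simp
next
  case False
  \<comment> \<open>The imaginary part of the root; its real part is \<open>c / s\<close>.\<close>
  define b where "b = sqrt (1 - c\<^sup>2) / s"
  have c2: "c\<^sup>2 < 1" using False c by (simp add: abs_square_less_1)
  then have b: "b \<noteq> 0" "b\<^sup>2 = (1 - c\<^sup>2) / s\<^sup>2"
    using s by (auto simp: b_def power_divide)
  have "(k - (c / s) *\<^sub>R 1) * (k - (c / s) *\<^sub>R 1) + b\<^sup>2 *\<^sub>R 1
      = k * k - (2 * (c / s)) *\<^sub>R k + ((c / s) * (c / s) + b\<^sup>2) *\<^sub>R 1"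
    by (simp only: mult_2 scaleR_add_left left_diff_distrib right_diff_distrib mult_scaleR_left
        mult_scaleR_right mult_1_left mult_1_right scaleR_scaleR) (simp add: algebra_simps)
  also have "(c / s) * (c / s) + b\<^sup>2 = 1 / s\<^sup>2"
    unfolding b(2) by (simp add: power2_eq_square diff_divide_distrib)
  finally have "quad c (s *\<^sub>R k) = s\<^sup>2 *\<^sub>R ((k - (c / s) *\<^sub>R 1) * (k - (c / s) *\<^sub>R 1) + b\<^sup>2 *\<^sub>R 1)"
    using s unfolding quad_def by (simp add: scaleR_add_right scaleR_diff_right power2_eq_square mult_ac)
  then show ?thesis using spec[OF b(1)] s by (simp add: unit_elem_scaleR_iff)
qed

lemma double_angle_param:
  fixes c :: real
  assumes "\<bar>c\<bar> \<le> 1"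
  obtains d where "\<bar>d\<bar> \<le> 1" "c = 2 * d\<^sup>2 - 1"
proof
  show "c = 2 * (sqrt ((1 + c) / 2))\<^sup>2 - 1" using assms by (simp add: field_simps)
  show "\<bar>sqrt ((1 + c) / 2)\<bar> \<le> 1" using assms by simp
qed

text \<open>Averaging over the square roots of a point of the circle does not increase the distance
  between the resolvents of two elements, so closeness survives repeated squaring.\<close>

lemma resolvent_part_diff_power:
  fixes x y :: "'a::real_normed_algebra_1"
  assumes x: "\<And>c. \<bar>c\<bar> \<le> 1 \<Longrightarrow> unit_elem (quad c x)"
    and y: "\<And>c. \<bar>c\<bar> \<le> 1 \<Longrightarrow> unit_elem (quad c y)"
    and d: "\<And>c. \<bar>c\<bar> \<le> 1 \<Longrightarrow> norm (resolvent_part c x - resolvent_part c y) \<le> \<delta>"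
    and c: "\<bar>c\<bar> \<le> 1"
  shows "unit_elem (quad c (x ^ (2 ^ m))) \<and> unit_elem (quad c (y ^ (2 ^ m))) \<and>
    norm (resolvent_part c (x ^ (2 ^ m)) - resolvent_part c (y ^ (2 ^ m))) \<le> \<delta>"
  using c
proof (induction m arbitrary: c)
  case 0
  then show ?case using x y d by simp
next
  case (Suc m)
  obtain e where e: "\<bar>e\<bar> \<le> 1" "c = 2 * e\<^sup>2 - 1" using double_angle_param[OF Suc.prems] .
  define u v where "u = x ^ (2 ^ m)" and "v = y ^ (2 ^ m)"
  have sq: "x ^ (2 ^ Suc m) = u * u" "y ^ (2 ^ Suc m) = v * v"
    by (simp_all add: u_def v_def mult_2 power_add)
  have "\<bar>- e\<bar> \<le> 1" using e by simp
  note IH = Suc.IH[OF e(1), folded u_def v_def] Suc.IH[OF this, folded u_def v_def]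
  have un: "unit_elem (quad c (u * u))" "unit_elem (quad c (v * v))"
    using IH by (auto simp: e(2) quad_mult_minus[symmetric] intro: unit_elem_mult)
  have "2 *\<^sub>R (resolvent_part c (u * u) - resolvent_part c (v * v))
      = (resolvent_part e u - resolvent_part e v) + (resolvent_part (- e) u - resolvent_part (- e) v)"
    using resolvent_part_square[of e u] resolvent_part_square[of e v] IH
    by (simp add: e(2) scaleR_right_diff_distrib)
  then have "norm (2 *\<^sub>R (resolvent_part c (u * u) - resolvent_part c (v * v))) \<le> \<delta> + \<delta>"
    using IH by (simp only: norm_triangle_mono)
  then show ?case using un unfolding sq by simp
qed

text \<open>The real form of the spectral radius formula, for elements with real spectrum. The resolvents
  of \<open>s k\<close> and of \<open>k\<close> are uniformly close for \<open>s\<close> near \<open>1\<close>. Hence so are those of their \<open>2\<^sup>m\<close>-th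
  powers, but the powers of \<open>s k\<close> tend to \<open>0\<close> while those of \<open>k\<close> have norm \<open>1\<close>.\<close>

lemma norm_attained_in_real_spectrum:
  fixes k :: "'a::{real_normed_algebra_1, banach}"
  assumes norm: "\<And>m. norm (k ^ (2 ^ m)) = 1"
    and spec: "\<And>a b. b \<noteq> 0 \<Longrightarrow> unit_elem ((k - a *\<^sub>R 1) * (k - a *\<^sub>R 1) + b\<^sup>2 *\<^sub>R 1)"
  shows "\<not> unit_elem (1 - k) \<or> \<not> unit_elem (1 + k)"
proof (rule ccontr)
  assume "\<not> ?thesis"
  then have units: "unit_elem (1 - k)" "unit_elem (1 + k)" by auto
  have norm1: "norm k = 1" using norm[of 0] by simp
  note un = unit_elem_quad_scaled[OF eq_refl[OF norm1] spec units]
  \<comment> \<open>A compact set on which \<open>un\<close> applies: \<open>s\<close> must stay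
    positive and reach 1, so the lower end 1/2 is arbitrary.\<close>
  define S where "S = {1/2..1::real} \<times> {-1..1::real}"
  have "uniformly_continuous_on S (\<lambda>(s, c). resolvent_part c (s *\<^sub>R k))"
    by (intro compact_uniformly_continuous continuous_on_resolvent_part)
      (auto simp: S_def abs_le_iff intro!: un compact_Times)
  then obtain d where d: "d > 0" and
    close: "\<And>p q. p \<in> S \<Longrightarrow> q \<in> S \<Longrightarrow> dist q p < d \<Longrightarrow>
      dist (case q of (s, c) \<Rightarrow> resolvent_part c (s *\<^sub>R k))
        (case p of (s, c) \<Rightarrow> resolvent_part c (s *\<^sub>R k)) < 1/8"
    unfolding uniformly_continuous_on_def by (metis zero_less_divide_1_iff zero_less_numeral)
  define s where "s = max (1/2) (1 - d/2)"
  have s: "1/2 \<le> s" "s < 1" "1 - s < d" using d by (auto simp: s_def)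
  have diff: "norm (resolvent_part c k - resolvent_part c (s *\<^sub>R k)) \<le> 1/8" if "\<bar>c\<bar> \<le> 1" for c
    using close[of "(s, c)" "(1, c)"] s that
    by (auto simp: S_def dist_prod_def dist_norm abs_le_iff dist_real_def)
  have uk: "unit_elem (quad c k)" if "\<bar>c\<bar> \<le> 1" for c using un[of 1 c] that by simp
  have us: "unit_elem (quad c (s *\<^sub>R k))" if "\<bar>c\<bar> \<le> 1" for c using un[of s c] that s by simp
  note power = resolvent_part_diff_power[OF uk us diff, of 1]
  have "(\<lambda>n. s ^ n) \<longlonglongrightarrow> 0" using s by (intro LIMSEQ_power_zero) simp
  then have "\<forall>\<^sub>F n in sequentially. s ^ n < 1/9" by (rule order_tendstoD) simp
  then obtain N where "\<And>n. n \<ge> N \<Longrightarrow> s ^ n < 1/9" by (auto simp: eventually_sequentially)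
  \<comment> \<open>Here \<open>2 ^ N\<close> is at least \<open>N\<close>. The constants fit as
    follows: \<open>norm y < 1/9\<close> puts \<open>Y\<close> within 1/8 of 1, closeness then puts
    \<open>X\<close> within 1/4 of 1, and \<open>x = (X - 1) * (1 - x)\<close> gets norm at most 1/2
    instead of 1.\<close>
  then have sN: "s ^ (2 ^ N) < 1/9" by (simp add: less_imp_le)
  define x y where "x = k ^ (2 ^ N)" and "y = (s *\<^sub>R k) ^ (2 ^ N)"
  define X Y where "X = resolvent_part 1 x" and "Y = resolvent_part 1 y"
  have nx: "norm x = 1" using norm by (simp add: x_def)
  have ny: "norm y < 1/9" using sN s norm[of N] by (simp add: y_def scaleR_power)
  have "unit_elem (quad 1 x)" "norm (X - Y) \<le> 1/8"
    using power by (simp_all add: x_def y_def X_def Y_def)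
  then have "unit_elem (1 - x)"
    using unit_elem_commuting_factor[of "1 - x" "1 - x"] by (simp add: quad_one)
  then have X: "X * (1 - x) = 1" unfolding X_def by (rule resolvent_part_one)
  have "unit_elem (1 - y)" using ny by (intro unit_elem_one_minus) simp
  then have Y: "Y * (1 - y) = 1" unfolding Y_def by (rule resolvent_part_one)
  have "Y - 1 = Y * y" using Y by (simp add: algebra_simps)
  then have "norm (Y - 1) \<le> norm Y * norm y" using norm_mult_ineq[of Y y] by simp
  also have "\<dots> \<le> (norm (Y - 1) + 1) * (1/9)"
    using ny norm_triangle_ineq[of "Y - 1" 1] by (intro mult_mono) auto
  finally have "norm (Y - 1) \<le> 1/8" by simp
  then have X1: "norm (X - 1) \<le> 1/4"
    using \<open>norm (X - Y) \<le> 1/8\<close> norm_triangle_ineq[of "X - Y" "Y - 1"] by simp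
  have "x = (X - 1) * (1 - x)" using X by (simp add: algebra_simps)
  then have "norm x \<le> norm (X - 1) * norm (1 - x)" by (metis norm_mult_ineq)
  also have "\<dots> \<le> 1/4 * 2"
    using X1 nx norm_triangle_ineq4[of 1 x] by (intro mult_mono) auto
  finally show False using nx by simp
qed

section \<open>Square roots in Banach algebras\<close>

text \<open>Taylor coefficients of the square root of 1 - x at 0.\<close>

definition sqrt_coeff :: "nat \<Rightarrow> real" where
  "sqrt_coeff n = (1/2 gchoose n) * (-1) ^ n"

lemma sqrt_coeff_0: "sqrt_coeff 0 = 1"
  by (simp add: sqrt_coeff_def)

lemma minus_half_gbinomial_nonneg: "0 \<le> (-1) ^ n * ((-1/2 :: real) gchoose n)"
proof -
  have "(-1) ^ n * ((-1/2 :: real) gchoose n) = (real n - 1/2 gchoose n)"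
    by (subst gbinomial_negated_upper) (simp flip: mult.assoc power_mult_distrib)
  also have "\<dots> \<ge> 0"
    unfolding gbinomial_prod_rev by (intro divide_nonneg_pos prod_nonneg) auto
  finally show ?thesis .
qed

lemma sqrt_coeff_Suc_nonpos: "sqrt_coeff (Suc n) \<le> 0"
proof -
  have "(1/2 gchoose Suc n) = (1/2) * ((-1/2 :: real) gchoose n) / (1 + real n)"
    using gbinomial_absorption[of n "1/2 :: real"] by (simp add: field_simps)
  then have "sqrt_coeff (Suc n) = - ((-1) ^ n * ((-1/2 :: real) gchoose n) / (2 * (1 + real n)))"
    by (simp add: sqrt_coeff_def)
  then show ?thesis using minus_half_gbinomial_nonneg[of n] by simp
qed

text \<open>All coefficients after the first are nonpositive, while the partial sums are nonnegative
  by the closed form for alternating binomial sums; so the absolute values add up to at most the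
  first coefficient. This gives convergence on the closed unit ball, and the boundary does
  occur.\<close>

lemma sqrt_coeff_sum_bound: "(\<Sum>i<n. norm (sqrt_coeff (Suc i))) \<le> 1"
proof -
  have "(\<Sum>k\<le>n. sqrt_coeff k) \<ge> 0"
    using gbinomial_sum_lower_neg[of "1/2 :: real" n] minus_half_gbinomial_nonneg[of n]
    by (simp add: sqrt_coeff_def)
  moreover have "(\<Sum>k\<le>n. sqrt_coeff k) = 1 + (\<Sum>i<n. sqrt_coeff (Suc i))"
    by (simp add: sum.atMost_shift sqrt_coeff_0)
  moreover have "(\<Sum>i<n. norm (sqrt_coeff (Suc i))) = - (\<Sum>i<n. sqrt_coeff (Suc i))"
    using sqrt_coeff_Suc_nonpos by (simp add: sum_negf)
  ultimately show ?thesis by simp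
qed

lemma summable_sqrt_coeff: "summable (\<lambda>n. norm (sqrt_coeff (Suc n)))"
  by (rule summableI_nonneg_bounded[OF _ sqrt_coeff_sum_bound]) simp

text \<open>The binomial series for the square root of \<open>1 - g\<close>: the value is the root
  itself, not 1 minus a root.\<close>

definition one_minus_sqrt :: "'a::{real_normed_algebra_1, banach} \<Rightarrow> 'a" where
  "one_minus_sqrt g = (\<Sum>n. sqrt_coeff n *\<^sub>R g ^ n)"

context
  fixes g :: "'a::{real_normed_algebra_1, banach}"
  assumes g: "norm g \<le> 1"
begin

lemma norm_sqrt_term_le: "norm (sqrt_coeff n *\<^sub>R g ^ n) \<le> norm (sqrt_coeff n)"
proof -
  have "norm (g ^ n) \<le> 1"
    by (rule order.trans[OF norm_power_ineq]) (simp add: g power_le_one)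
  then show ?thesis by (simp add: mult_left_le)
qed

lemma summable_norm_sqrt_series: "summable (\<lambda>n. norm (sqrt_coeff n *\<^sub>R g ^ n))"
proof (rule summable_comparison_test)
  show "\<exists>N. \<forall>n\<ge>N. norm (norm (sqrt_coeff n *\<^sub>R g ^ n)) \<le> norm (sqrt_coeff n)"
    using norm_sqrt_term_le by auto
  show "summable (\<lambda>n. norm (sqrt_coeff n))"
    by (rule iffD1[OF summable_Suc_iff summable_sqrt_coeff])
qed

lemma summable_sqrt_series: "summable (\<lambda>n. sqrt_coeff n *\<^sub>R g ^ n)"
  by (rule summable_norm_cancel[OF summable_norm_sqrt_series])

lemma one_minus_sqrt_square: "one_minus_sqrt g * one_minus_sqrt g = 1 - g"
proof -
  have "(\<Sum>i\<le>k. (sqrt_coeff i *\<^sub>R g ^ i) * (sqrt_coeff (k - i) *\<^sub>R g ^ (k - i)))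
      = (if k = 0 then 1 else if k = 1 then - g else 0)" for k
  proof -
    have "(\<Sum>i\<le>k. (sqrt_coeff i *\<^sub>R g ^ i) * (sqrt_coeff (k - i) *\<^sub>R g ^ (k - i)))
        = (\<Sum>i\<le>k. ((-1) ^ k * ((1/2 gchoose i) * (1/2 gchoose (k - i)))) *\<^sub>R g ^ k)"
    proof (rule sum.cong)
      fix i assume "i \<in> {..k}"
      then obtain j where k: "k = i + j" by (auto simp: le_iff_add)
      show "(sqrt_coeff i *\<^sub>R g ^ i) * (sqrt_coeff (k - i) *\<^sub>R g ^ (k - i))
        = ((-1) ^ k * ((1/2 gchoose i) * (1/2 gchoose (k - i)))) *\<^sub>R g ^ k"
        unfolding k by (simp add: sqrt_coeff_def power_add mult_ac)
    qed simp
    also have "\<dots> = ((-1) ^ k * (\<Sum>i\<le>k. (1/2 gchoose i) * (1/2 gchoose (k - i)))) *\<^sub>R g ^ k"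
      by (simp add: sum_distrib_left scaleR_sum_left)
    \<comment> \<open>Vandermonde with 1/2 + 1/2 = 1, which leaves only the coefficients of
      \<open>1 - g\<close>.\<close>
    also have "(\<Sum>i\<le>k. (1/2 gchoose i) * ((1/2 :: real) gchoose (k - i))) = (1 gchoose k)"
      using gbinomial_Vandermonde[of "1/2 :: real" "1/2" k] by (simp add: atLeast0AtMost)
    also have "(1 gchoose k) = (real (1 choose k))"
      by (simp add: binomial_gbinomial)
    also have "(1 choose k) = (if k \<le> 1 then 1 else 0)"
      by (auto simp: le_Suc_eq)
    finally show ?thesis by (auto simp: le_Suc_eq)
  qed
  then have "one_minus_sqrt g * one_minus_sqrt g = (\<Sum>k. if k = 0 then 1 else if k = 1 then - g else 0)"
    unfolding one_minus_sqrt_def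
    by (subst Cauchy_product[OF summable_norm_sqrt_series summable_norm_sqrt_series]) simp
  also have "\<dots> = (\<Sum>k\<in>{0, 1}. if k = 0 then 1 else if k = (1::nat) then - g else 0)"
    by (rule suminf_finite) auto
  finally show ?thesis by simp
qed

text \<open>The total mass of the coefficients after the first is at most 1. This bound is what
  makes the root a positive element.\<close>

lemma norm_one_minus_one_minus_sqrt: "norm (1 - one_minus_sqrt g) \<le> 1"
proof -
  let ?f = "\<lambda>n. norm (sqrt_coeff (Suc n) *\<^sub>R g ^ Suc n)"
  have "summable ?f" using summable_norm_sqrt_series by (subst summable_Suc_iff)
  have "one_minus_sqrt g = 1 + (\<Sum>n. sqrt_coeff (Suc n) *\<^sub>R g ^ Suc n)"
    unfolding one_minus_sqrt_def using suminf_split_head[OF summable_sqrt_series]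
    by (simp add: sqrt_coeff_0)
  then have "norm (1 - one_minus_sqrt g) = norm (\<Sum>n. sqrt_coeff (Suc n) *\<^sub>R g ^ Suc n)"
    by simp
  also have "\<dots> \<le> suminf ?f" by (rule summable_norm) fact
  also have "\<dots> \<le> (\<Sum>n. norm (sqrt_coeff (Suc n)))"
    by (rule suminf_le[OF norm_sqrt_term_le \<open>summable ?f\<close> summable_sqrt_coeff])
  also have "\<dots> \<le> 1" by (rule suminf_le_const[OF summable_sqrt_coeff sqrt_coeff_sum_bound])
  finally show ?thesis .
qed

lemma one_minus_sqrt_commute:
  assumes "x * g = g * x" shows "x * one_minus_sqrt g = one_minus_sqrt g * x"
  unfolding one_minus_sqrt_def
  by (simp add: suminf_mult[OF summable_sqrt_series, symmetric] suminf_mult2[OF summable_sqrt_series]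
      power_commuting_commutes[OF assms[symmetric]])

end

section \<open>Positive elements\<close>

context unital_cstar_algebra
begin

section \<open>Norm and spectrum of self-adjoint elements\<close>

lemma star_scaleR: "star (r *\<^sub>R x) = r *\<^sub>R star x"
  using star_scale[OF real_in_scalars[of r], of x] by (simp add: scale_of_real)

lemma star_minus: "star (- x) = - star x"
  using star_scaleR[of "-1" x] by simp

lemma star_diff: "star (x - y) = star x - star y"
  using star_add[of x "- y"] by (simp add: star_minus)

lemma star_zero: "star 0 = 0"
  using star_scaleR[of 0 0] by simp

lemma star_one: "star 1 = 1"
  using star_mult[of "star 1" 1] by (simp add: star_star)

lemma norm_star: "norm (star x) = norm x"
proof -
  have le: "norm y \<le> norm (star y)" for y
  proof (cases "y = 0")
    case False
    have "norm y * norm y \<le> norm (star y) * norm y"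
      using cstar_identity[of y] norm_mult_ineq[of "star y" y] by (simp add: power2_eq_square)
    then show ?thesis using False by simp
  qed simp
  show ?thesis using le[of x] le[of "star x"] by (simp add: star_star)
qed

lemma bounded_linear_star: "bounded_linear star"
  by (rule bounded_linear_intro[of _ 1]) (auto simp: star_add star_scaleR norm_star)

lemma star_power: "star (x ^ n) = star x ^ n"
  by (induction n) (simp_all add: star_one star_mult power_commutes)

lemma star_one_minus_sqrt:
  assumes "star g = g" "norm g \<le> 1" shows "star (one_minus_sqrt g) = one_minus_sqrt g"
  unfolding one_minus_sqrt_def
  by (subst bounded_linear.suminf[OF bounded_linear_star summable_sqrt_series])
    (simp_all add: assms star_scaleR star_power)

lemma norm_selfadjoint_square: "star k = k \<Longrightarrow> norm (k * k) = norm k * norm k"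
  using cstar_identity[of k] by (simp add: power2_eq_square)

text \<open>Over \<real> this is an instance of an axiom. Over \<complex> the element is (1 - ip)(1
  + ip), with \<open>j\<close> the central copy of i in the algebra, and each factor lies in a ball
  about a scalar.\<close>

lemma unit_one_plus_selfadjoint_square:
  assumes p: "star p = p" shows "unit_elem (1 + p * p)"
proof (cases "F = \<real>")
  case True
  show ?thesis using real_invertible[OF True, of p] by (simp add: p unit_elem_def)
next
  case False
  then have F: "c \<in> F" for c using scalars by auto
  define j where "j = scale \<i> 1"
  have comm: "j * x = x * j" for x
    by (simp add: j_def scale_mult_left[OF F] scale_mult_right[OF F])
  have jj: "j * j = - 1"
    using scale_scale[OF F F, of 1 \<i> \<i>] scale_minus_one[of 1]
    by (simp add: j_def scale_mult_left[OF F])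
  have sj: "star j = - j"
    using star_scale[OF F, of \<i> 1] scale_scale[OF F F, of 1 "-1" \<i>] scale_minus_one[of j]
    by (simp add: j_def star_one)
  have unit: "unit_elem (1 - j * q)" if q: "star q = q" for q
  proof (rule unit_elem_near_scalar)
    \<comment> \<open>By the norm identity the ball condition follows from
      \<open>t\<^sup>2 + (norm q)\<^sup>2 < (1 + t)\<^sup>2\<close>, and this \<open>t\<close> is
      large enough.\<close>
    define t where "t = (norm q)\<^sup>2"
    have t: "t \<ge> 0" by (simp add: t_def)
    have "star (t *\<^sub>R 1 + j * q) * (t *\<^sub>R 1 + j * q) = t\<^sup>2 *\<^sub>R 1 - (j * j) * (q * q)"
      using comm[of q] by (simp add: star_add star_scaleR star_one star_mult sj q algebra_simps power2_eq_square)
        (metis comm mult.assoc)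
    then have "(norm (t *\<^sub>R 1 + j * q))\<^sup>2 = norm (t\<^sup>2 *\<^sub>R 1 + q * q)"
      by (simp add: jj flip: cstar_identity)
    also have "\<dots> \<le> t\<^sup>2 + t"
      using norm_triangle_ineq[of "t\<^sup>2 *\<^sub>R 1" "q * q"] norm_selfadjoint_square[OF q]
      by (simp add: t_def power2_eq_square)
    also have "\<dots> < (1 + t)\<^sup>2" using t by (simp add: power2_eq_square algebra_simps)
    finally have "norm (t *\<^sub>R 1 + j * q) < 1 + t"
      using t by (intro power2_less_imp_less[of _ "1 + t"]) auto
    then show "norm ((1 + t) *\<^sub>R 1 - (1 - j * q)) < 1 + t"
      by (simp add: algebra_simps)
  qed
  have "(1 - j * p) * (1 - j * (- p)) = 1 - (j * j) * (p * p)"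
    using comm[of p] by (simp add: algebra_simps) (metis comm mult.assoc)
  then show ?thesis
    using unit_elem_mult[OF unit[OF p] unit[of "- p"]] by (simp add: jj star_minus p)
qed

lemma unit_scalar_plus_selfadjoint_square:
  assumes p: "star p = p" and t: "t > 0" shows "unit_elem (t *\<^sub>R 1 + p * p)"
proof -
  have "t *\<^sub>R 1 + p * p = t *\<^sub>R (1 + (inverse (sqrt t) *\<^sub>R p) * (inverse (sqrt t) *\<^sub>R p))"
    using t by (simp add: scaleR_add_right flip: inverse_mult_distrib)
  then show ?thesis
    using unit_one_plus_selfadjoint_square[of "inverse (sqrt t) *\<^sub>R p"] p t
    by (simp add: unit_elem_scaleR star_scaleR)
qed

text \<open>After scaling to norm 1, the norm identity keeps every \<open>h ^ (2 ^ m)\<close> at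
  norm 1, and non-real spectrum is excluded because \<open>h - a *\<^sub>R 1\<close> is again
  self-adjoint.\<close>

lemma selfadjoint_norm_spectrum:
  assumes k: "star k = k"
  shows "\<not> unit_elem (norm k *\<^sub>R 1 - k) \<or> \<not> unit_elem (norm k *\<^sub>R 1 + k)"
proof (cases "k = 0")
  case True
  then show ?thesis by (simp add: unit_elem_def)
next
  case False
  define h where "h = inverse (norm k) *\<^sub>R k"
  have h: "star h = h" "norm h = 1" using False by (auto simp: h_def star_scaleR k)
  have "norm (h ^ (2 ^ m)) = 1" for m
  proof (induction m)
    case (Suc m)
    have "h ^ (2 ^ Suc m) = h ^ (2 ^ m) * h ^ (2 ^ m)" by (simp add: mult_2 power_add)
    then show ?case
      using Suc norm_selfadjoint_square[of "h ^ (2 ^ m)"] by (simp add: star_power h)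
  qed (simp add: h)
  moreover have "unit_elem ((h - a *\<^sub>R 1) * (h - a *\<^sub>R 1) + b\<^sup>2 *\<^sub>R 1)" if "b \<noteq> 0" for a b
    using unit_scalar_plus_selfadjoint_square[of "h - a *\<^sub>R 1" "b\<^sup>2"] that
    by (simp add: star_diff star_scaleR star_one h add.commute)
  ultimately have "\<not> unit_elem (1 - h) \<or> \<not> unit_elem (1 + h)"
    by (rule norm_attained_in_real_spectrum)
  moreover have "norm k *\<^sub>R 1 - k = norm k *\<^sub>R (1 - h)" "norm k *\<^sub>R 1 + k = norm k *\<^sub>R (1 + h)"
    using False by (simp_all add: h_def algebra_simps)
  ultimately show ?thesis using False by (simp add: unit_elem_scaleR_iff)
qed

text \<open>A norm condition in place of nonnegative spectrum: sums and limits of scale are then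
  handled by the triangle inequality. \<open>positive_imp_unit\<close> and \<open>positiveI\<close>
  recover the spectral description.\<close>

definition positive :: "'a \<Rightarrow> bool" where
  "positive h \<longleftrightarrow> star h = h \<and> (\<exists>t\<ge>0. norm (t *\<^sub>R 1 - h) \<le> t)"

lemma positive_selfadjoint: "positive h \<Longrightarrow> star h = h"
  by (simp add: positive_def)

lemma positive_zero: "positive 0"
  by (auto simp: positive_def star_zero)

lemma positive_add:
  assumes "positive h" "positive k" shows "positive (h + k)"
proof -
  obtain s t where "s \<ge> 0" "t \<ge> 0" "norm (s *\<^sub>R 1 - h) \<le> s" "norm (t *\<^sub>R 1 - k) \<le> t"
    using assms by (auto simp: positive_def)
  moreover have "(s + t) *\<^sub>R 1 - (h + k) = (s *\<^sub>R 1 - h) + (t *\<^sub>R 1 - k)"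
    by (simp add: algebra_simps)
  ultimately have "norm ((s + t) *\<^sub>R 1 - (h + k)) \<le> s + t" "s + t \<ge> 0"
    using norm_triangle_mono by (metis, simp)
  then show ?thesis using assms by (auto simp: positive_def star_add)
qed

lemma positive_scaleR:
  assumes "positive h" "r \<ge> 0" shows "positive (r *\<^sub>R h)"
proof -
  obtain t where t: "t \<ge> 0" "norm (t *\<^sub>R 1 - h) \<le> t" using assms by (auto simp: positive_def)
  have "norm ((r * t) *\<^sub>R 1 - r *\<^sub>R h) = r * norm (t *\<^sub>R 1 - h)"
    using assms(2) by (simp flip: scaleR_right_diff_distrib scaleR_scaleR)
  then have "norm ((r * t) *\<^sub>R 1 - r *\<^sub>R h) \<le> r * t" using t assms(2) by (simp add: mult_left_mono)
  then show ?thesis using assms t by (auto simp: positive_def star_scaleR intro!: exI[of _ "r * t"])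
qed

lemma positive_scalar_minus:
  assumes "star h = h" "norm h \<le> s" shows "positive (s *\<^sub>R 1 - h)"
proof -
  have "s \<ge> 0" using assms(2) norm_ge_zero[of h] by linarith
  then show ?thesis
    using assms by (auto simp: positive_def star_diff star_scaleR star_one intro!: exI[of _ s])
qed

lemma positive_imp_unit:
  assumes "positive h" "\<delta> > 0" shows "unit_elem (\<delta> *\<^sub>R 1 + h)"
proof -
  obtain t where t: "t \<ge> 0" "norm (t *\<^sub>R 1 - h) \<le> t" using assms by (auto simp: positive_def)
  have "norm ((\<delta> + t) *\<^sub>R 1 - (\<delta> *\<^sub>R 1 + h)) < \<delta> + t"
    using t assms(2) by (simp add: algebra_simps)
  then show ?thesis by (rule unit_elem_near_scalar)
qed

text \<open>The radius \<open>norm h\<close> works. If \<open>k = norm h *\<^sub>R 1 - h\<close>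
  were longer than \<open>h\<close>, neither \<open>norm k\<close> nor its negative could be in the
  spectrum of \<open>k\<close>: the first by hypothesis, the second by the ball criterion.\<close>

lemma positiveI:
  assumes h: "star h = h" and unit: "\<And>t. t > 0 \<Longrightarrow> unit_elem (t *\<^sub>R 1 + h)"
  shows "positive h"
proof -
  define k where "k = norm h *\<^sub>R 1 - h"
  have "norm k \<le> norm h"
  proof (rule ccontr)
    assume "\<not> norm k \<le> norm h"
    then have less: "norm h < norm k" by simp
    have "norm k *\<^sub>R 1 - k = (norm k - norm h) *\<^sub>R 1 + h"
      by (simp add: k_def algebra_simps)
    then have "unit_elem (norm k *\<^sub>R 1 - k)" using unit[of "norm k - norm h"] less by simp
    moreover have "unit_elem (norm k *\<^sub>R 1 + k)"
    proof (rule unit_elem_near_scalar)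
      have "(norm k + norm h) *\<^sub>R 1 - (norm k *\<^sub>R 1 + k) = h" by (simp add: k_def algebra_simps)
      then show "norm ((norm k + norm h) *\<^sub>R 1 - (norm k *\<^sub>R 1 + k)) < norm k + norm h"
        using less by (simp add: order.strict_trans1[OF norm_ge_zero less] del: zero_less_norm_iff)
    qed
    moreover have "star k = k" by (simp add: k_def star_diff star_scaleR star_one h)
    ultimately show False using selfadjoint_norm_spectrum by blast
  qed
  then show ?thesis using h by (auto simp: positive_def k_def intro!: exI[of _ "norm h"])
qed

text \<open>For \<open>norm u > s\<close>, both \<open>norm u\<close> and its negative would lie
  outside the spectrum of \<open>u\<close>.\<close>

lemma norm_le_of_positive_diff:
  assumes u: "positive u" and su: "positive (s *\<^sub>R 1 - u)" and s: "s \<ge> 0"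
  shows "norm u \<le> s"
proof (rule ccontr)
  assume "\<not> norm u \<le> s"
  then have less: "s < norm u" by simp
  have "norm u *\<^sub>R 1 - u = (norm u - s) *\<^sub>R 1 + (s *\<^sub>R 1 - u)" by (simp add: algebra_simps)
  then have "unit_elem (norm u *\<^sub>R 1 - u)"
    using positive_imp_unit[OF su, of "norm u - s"] less by (metis diff_gt_0_iff_gt)
  moreover have "unit_elem (norm u *\<^sub>R 1 + u)"
    by (rule positive_imp_unit[OF u order.strict_trans1[OF s less]])
  ultimately show False using selfadjoint_norm_spectrum[OF positive_selfadjoint[OF u]] by blast
qed

lemma norm_positive_mono:
  assumes "positive u" "positive w" shows "norm u \<le> norm (u + w)"
proof (rule norm_le_of_positive_diff[OF assms(1)])
  have "positive (norm (u + w) *\<^sub>R 1 - (u + w))"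
    by (intro positive_scalar_minus) (simp_all add: star_add assms positive_selfadjoint)
  from positive_add[OF this assms(2)] show "positive (norm (u + w) *\<^sub>R 1 - u)"
    by (simp add: algebra_simps)
qed simp

lemma positive_antisym:
  assumes "positive h" "positive (- h)" shows "h = 0"
  using norm_positive_mono[OF assms] by simp

lemma positive_selfadjoint_square: "star p = p \<Longrightarrow> positive (p * p)"
  by (intro positiveI unit_scalar_plus_selfadjoint_square) (simp_all add: star_mult)

text \<open>The ball condition says that \<open>h\<close> is \<open>t\<close> times
  \<open>1 - g\<close> with \<open>norm g \<le> 1\<close>, so the binomial series applies. The
  commutation clause stands in for a functional calculus.\<close>

lemma positive_sqrt:
  assumes h: "positive h"
  obtains s where "positive s" "s * s = h" "\<And>x. x * h = h * x \<Longrightarrow> x * s = s * x"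
proof -
  obtain t where t: "t \<ge> 0" "norm (t *\<^sub>R 1 - h) \<le> t" using h by (auto simp: positive_def)
  show thesis
  proof (cases "t = 0")
    case True
    then have "h = 0" using t by simp
    then show thesis using that[of 0] positive_zero by simp
  next
    case False
    define g where "g = inverse t *\<^sub>R (t *\<^sub>R 1 - h)"
    define s where "s = sqrt t *\<^sub>R one_minus_sqrt g"
    have pos: "t > 0" using t False by simp
    have g: "norm g \<le> 1" unfolding g_def norm_scaleR using t pos by (simp add: field_simps)
    have sg: "star g = g"
      using positive_selfadjoint[OF h] by (simp add: g_def star_scaleR star_diff star_one)
    have "star s = s" using star_one_minus_sqrt[OF sg g] by (simp add: s_def star_scaleR)
    moreover have "norm (sqrt t *\<^sub>R 1 - s) \<le> sqrt t"
    proof -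
      have "norm (sqrt t *\<^sub>R 1 - s) = sqrt t * norm (1 - one_minus_sqrt g)"
        using pos by (simp add: s_def flip: scaleR_right_diff_distrib)
      also have "\<dots> \<le> sqrt t * 1"
        using norm_one_minus_one_minus_sqrt[OF g] pos by (intro mult_left_mono) auto
      finally show ?thesis by simp
    qed
    ultimately have "positive s" using pos by (auto simp: positive_def intro!: exI[of _ "sqrt t"])
    moreover have "s * s = h"
    proof -
      have "s * s = t *\<^sub>R (1 - g)" using pos by (simp add: s_def one_minus_sqrt_square[OF g])
      also have "\<dots> = h" using pos by (simp add: g_def algebra_simps)
      finally show ?thesis .
    qed
    moreover have "x * s = s * x" if "x * h = h * x" for x
    proof -
      have "x * g = g * x" using that by (simp add: g_def algebra_simps)
      then show ?thesis using one_minus_sqrt_commute[OF g] by (simp add: s_def)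
    qed
    ultimately show thesis using that by blast
  qed
qed

text \<open>The inverse is explicit: (1 - y z x)/t, where z is the inverse of
  \<open>t *\<^sub>R 1 + x * y\<close>. Thus \<open>x * y\<close> and \<open>y * x\<close> have the
  same nonzero spectrum.\<close>

lemma unit_elem_scalar_plus_swap:
  fixes x y :: 'a
  assumes "unit_elem (t *\<^sub>R 1 + x * y)" "t \<noteq> 0" shows "unit_elem (t *\<^sub>R 1 + y * x)"
proof -
  define z where "z = unit_inv (t *\<^sub>R 1 + x * y)"
  have z: "t *\<^sub>R z + x * y * z = 1" "t *\<^sub>R z + z * (x * y) = 1"
    using unit_inv[OF assms(1)] by (simp_all add: z_def algebra_simps)
  have "y * (t *\<^sub>R z + x * y * z) * x = y * x" "y * (t *\<^sub>R z + z * (x * y)) * x = y * x"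
    unfolding z by simp_all
  then have "(t *\<^sub>R 1 + y * x) * (1 - y * z * x) = t *\<^sub>R 1"
    "(1 - y * z * x) * (t *\<^sub>R 1 + y * x) = t *\<^sub>R 1"
    by (simp_all add: algebra_simps)
  then have "(t *\<^sub>R 1 + y * x) * (inverse t *\<^sub>R (1 - y * z * x)) = 1"
    "(inverse t *\<^sub>R (1 - y * z * x)) * (t *\<^sub>R 1 + y * x) = 1"
    using assms(2) by simp_all
  then show ?thesis by (rule unit_elemI[rotated])
qed

text \<open>In the complex case this is the theorem of Kelley and Vaught: with \<open>h = x\<^sup>* x\<close>,
  \<open>m = \<bar>h\<bar>\<close> and \<open>g = m - h\<close>, the element \<open>y = x g\<close> satisfies \<open>y\<^sup>* y = - g m g \<le> 0\<close>, whereas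
  \<open>y\<^sup>* y + y y\<^sup>*\<close> is a sum of squares of self-adjoint elements and \<open>y\<^sup>* y\<close>, \<open>y y\<^sup>*\<close> have the same
  nonzero spectrum. Hence \<open>y = 0\<close> and then \<open>g = 0\<close>.\<close>

lemma positive_star_mult: "positive (star x * x)"
proof (cases "F = \<real>")
  case True
  show ?thesis
  proof (rule positiveI)
    fix t :: real assume t: "t > 0"
    define y where "y = inverse (sqrt t) *\<^sub>R x"
    have "unit_elem (1 + star y * y)" using real_invertible[OF True, of y] by (simp add: unit_elem_def)
    moreover have "t *\<^sub>R 1 + star x * x = t *\<^sub>R (1 + star y * y)"
      using t by (simp add: y_def star_scaleR scaleR_add_right flip: inverse_mult_distrib)
    ultimately show "unit_elem (t *\<^sub>R 1 + star x * x)" using t by (simp add: unit_elem_scaleR)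
  qed (simp add: star_mult star_star)
next
  case False
  then have F: "c \<in> F" for c using scalars by auto
  define h where "h = star x * x"
  have h: "star h = h" by (simp add: h_def star_mult star_star)
  obtain m where m: "positive m" "m * m = h * h" "m * h = h * m"
    using positive_sqrt[OF positive_selfadjoint_square[OF h]] by (metis mult.assoc)
  \<comment> \<open>The root \<open>r\<close> of \<open>m\<close> turns \<open>g * m * g\<close>
    into the square of the self-adjoint \<open>r * g\<close>; its commutation clause carries
    \<open>g\<close> past it.\<close>
  obtain r where r: "positive r" "r * r = m" "\<And>x. x * m = m * x \<Longrightarrow> x * r = r * x"
    using positive_sqrt[OF m(1)] by metis
  define g where "g = m - h"
  have g: "star g = g" using m(1) h by (simp add: g_def star_diff positive_selfadjoint)
  have gm: "g * m = m * g" using m(3) by (simp add: g_def algebra_simps)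
  have hg: "h * g = - (m * g)" using m by (simp add: g_def algebra_simps)
  have gr: "g * r = r * g" using r(3)[OF gm] .
  define w where "w = r * g"
  have w: "star w = w" using r(1) g gr by (simp add: w_def star_mult positive_selfadjoint)
  have ww: "w * w = g * m * g"
    using gr r(2) by (metis mult.assoc w_def)
  define y where "y = x * g"
  have "star y * y = g * (h * g)" by (simp add: y_def star_mult g h_def mult.assoc)
  then have yy: "star y * y = - (w * w)" by (simp add: hg ww mult.assoc)
  define j where "j = scale \<i> (y - star y)"
  have star_j: "star j = j"
    using star_scale[OF F, of \<i> "y - star y"] scale_scale[OF F F, of "star y - y" "-1" \<i>]
      scale_scale[OF F F, of "y - star y" "-1" "\<i>"] scale_scale[OF F F, of "star y - y" \<i> "-1"]
      scale_minus_one[of "star y - y"]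
    by (simp add: j_def star_diff star_star)
  have jj: "j * j = - ((y - star y) * (y - star y))"
    using scale_scale[OF F F, of "(y - star y) * (y - star y)" \<i> \<i>] scale_minus_one
    by (simp add: j_def scale_mult_left[OF F] scale_mult_right[OF F])
  have star_y: "star (y + star y) = y + star y" by (simp add: star_add star_star add.commute)
  \<comment> \<open>Since \<open>j * j\<close> is minus the square of \<open>y - star y\<close>, the
    two squares add up to twice \<open>y * star y + star y * y\<close>, and
    \<open>star y * y\<close> is \<open>- (w * w)\<close>.\<close>
  have "2 *\<^sub>R (y * star y) = ((y + star y) * (y + star y) + j * j) + 2 *\<^sub>R (w * w)"
    using yy by (simp add: jj algebra_simps scaleR_2)
  then have eq: "y * star y = (1/2) *\<^sub>R ((y + star y) * (y + star y) + j * j) + w * w"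
    by (metis (no_types, lifting) divide_self_if one_neq_zero scaleR_add_right scaleR_half_double scaleR_one scaleR_2)
  have pos: "positive (y * star y)"
    unfolding eq
    by (intro positive_add positive_scaleR positive_selfadjoint_square star_j star_y w) simp
  have "unit_elem (t *\<^sub>R 1 + star y * y)" if "t > 0" for t
    using unit_elem_scalar_plus_swap[OF positive_imp_unit[OF pos that]] that by simp
  then have "positive (star y * y)" by (intro positiveI) (simp_all add: star_mult star_star)
  then have "positive (- (w * w))" by (simp add: yy)
  then have "w * w = 0" using positive_antisym[OF positive_selfadjoint_square[OF w]] by simp
  then have "w = 0" using norm_selfadjoint_square[OF w] by simp
  \<comment> \<open>Here \<open>m * g = r * w\<close>. Hence \<open>h * g\<close> vanishes too, and
    \<open>g * g\<close> is the difference of the two.\<close>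
  then have "m * g = 0" using r(2) by (metis mult.assoc mult_zero_right w_def)
  then have "g * g = 0" using hg by (simp add: g_def left_diff_distrib)
  then have "g = 0" using norm_selfadjoint_square[OF g] by simp
  then show ?thesis using m(1) by (simp add: g_def h_def)
qed

lemma positive_conjugate:
  assumes "positive h" shows "positive (star x * h * x)"
proof -
  obtain s where s: "positive s" "s * s = h" using positive_sqrt[OF assms] by metis
  have "star x * h * x = star (s * x) * (s * x)"
    using s by (simp add: star_mult positive_selfadjoint mult.assoc)
      (metis mult.assoc)
  then show ?thesis by (simp add: positive_star_mult)
qed

end

section \<open>The Hahn--Banach theorem\<close>

definition sublinear :: "('v::real_vector \<Rightarrow> real) \<Rightarrow> bool" where
  "sublinear q \<longleftrightarrow> (\<forall>x y. q (x + y) \<le> q x + q y) \<and> (\<forall>r\<ge>0. \<forall>x. q (r *\<^sub>R x) = r * q x)"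

lemma sublinear_add: "sublinear q \<Longrightarrow> q (x + y) \<le> q x + q y"
  and sublinear_scaleR: "sublinear q \<Longrightarrow> r \<ge> 0 \<Longrightarrow> q (r *\<^sub>R x) = r * q x"
  by (auto simp: sublinear_def)

lemma sublinear_zero: "sublinear q \<Longrightarrow> q 0 = 0"
  using sublinear_scaleR[of q 0 0] by simp

lemma sublinear_minus: "sublinear q \<Longrightarrow> - q (- x) \<le> q x"
  using sublinear_add[of q x "- x"] sublinear_zero[of q] by simp

text \<open>The scaling inequality for \<open>inverse r\<close> is the reverse inequality for
  \<open>r\<close>.\<close>

lemma sublinearI:
  assumes add: "\<And>x y. q (x + y) \<le> q x + q y" and zero: "q 0 \<le> 0"
    and scale: "\<And>r x. r > 0 \<Longrightarrow> q (r *\<^sub>R x) \<le> r * q x"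
  shows "sublinear q"
  unfolding sublinear_def
proof (intro conjI allI impI)
  fix r :: real and x assume "r \<ge> 0"
  show "q (r *\<^sub>R x) = r * q x"
  proof (cases "r = 0")
    case True
    then show ?thesis using add[of 0 0] zero by simp
  next
    case False
    with \<open>r \<ge> 0\<close> have r: "r > 0" by simp
    have "q x \<le> inverse r * q (r *\<^sub>R x)" using scale[of "inverse r" "r *\<^sub>R x"] r by simp
    then have "r * q x \<le> q (r *\<^sub>R x)" using r by (simp add: field_simps)
    then show ?thesis using scale[OF r, of x] by simp
  qed
qed (rule add)

text \<open>The pairs \<open>(x, v)\<close> with \<open>P x v\<close> form a convex cone, whose
  lower boundary is the infimum; \<open>L\<close> keeps it finite. All sublinear functionals
  constructed below arise in this way.\<close>

lemma sublinear_Inf: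
  fixes P :: "'v::real_vector \<Rightarrow> real \<Rightarrow> bool"
  assumes ex: "\<And>x. \<exists>v. P x v" and bound: "\<And>x v. P x v \<Longrightarrow> L x \<le> v"
    and add: "\<And>x y v w. P x v \<Longrightarrow> P y w \<Longrightarrow> P (x + y) (v + w)"
    and scale: "\<And>r x v. r > 0 \<Longrightarrow> P x v \<Longrightarrow> P (r *\<^sub>R x) (r * v)"
    and zero: "P 0 0"
  shows "sublinear (\<lambda>x. Inf {v. P x v})"
proof (rule sublinearI)
  have bdd: "bdd_below {v. P x v}" for x by (rule bdd_belowI[of _ "L x"]) (auto dest: bound)
  have lower: "Inf {v. P x v} \<le> v" if "P x v" for x v
    using that by (intro cInf_lower bdd) simp
  have greatest: "u \<le> Inf {v. P x v}" if "\<And>v. P x v \<Longrightarrow> u \<le> v" for x u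
    using ex that by (intro cInf_greatest) auto
  show "Inf {v. P 0 v} \<le> 0" using zero by (rule lower)
  show "Inf {v. P (x + y) v} \<le> Inf {v. P x v} + Inf {v. P y v}" for x y
  proof -
    have "Inf {v. P (x + y) v} - w \<le> Inf {v. P x v}" if "P y w" for w
      using lower[OF add[OF _ that]] by (intro greatest) (simp add: diff_le_eq)
    then have "Inf {v. P (x + y) v} - Inf {v. P x v} \<le> Inf {v. P y v}"
      by (intro greatest) (simp add: algebra_simps)
    then show ?thesis by simp
  qed
  show "Inf {v. P (r *\<^sub>R x) v} \<le> r * Inf {v. P x v}" if r: "r > 0" for r x
  proof -
    have "Inf {v. P (r *\<^sub>R x) v} / r \<le> Inf {v. P x v}"
      using lower[OF scale[OF r]] r by (intro greatest) (simp add: field_simps)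
    then show ?thesis using r by (simp add: field_simps)
  qed
qed

text \<open>Take the infimum of p(x + t y) - t p(y) over t \<ge> 0: t = 0 gives
  \<open>q \<le> p\<close>, t = 1 gives the bound at \<open>- y\<close>, and -p(-x) is a lower
  bound.\<close>

lemma sublinear_directional:
  fixes p :: "'v::real_vector \<Rightarrow> real"
  assumes p: "sublinear p"
  obtains q where "sublinear q" "q \<le> p" "q (- y) \<le> - p y"
proof -
  define P where "P x v \<longleftrightarrow> (\<exists>t\<ge>0. p (x + t *\<^sub>R y) - t * p y \<le> v)" for x v
  define q where "q x = Inf {v. P x v}" for x
  have bound: "- p (- x) \<le> v" if "P x v" for x v
  proof -
    obtain t where t: "t \<ge> 0" "p (x + t *\<^sub>R y) - t * p y \<le> v" using \<open>P x v\<close> by (auto simp: P_def)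
    have "p (t *\<^sub>R y) \<le> p (x + t *\<^sub>R y) + p (- x)"
      using sublinear_add[OF p, of "x + t *\<^sub>R y" "- x"] by simp
    then show ?thesis using t sublinear_scaleR[OF p t(1), of y] by simp
  qed
  have "sublinear (\<lambda>x. Inf {v. P x v})"
  proof (rule sublinear_Inf[where L = "\<lambda>x. - p (- x)"])
    show "\<exists>v. P x v" for x unfolding P_def by (intro exI[of _ "p x"] exI[of _ 0]) simp
    show "P 0 0" unfolding P_def by (intro exI[of _ 0]) (simp add: sublinear_zero[OF p])
    show "P (x + z) (v + w)" if "P x v" "P z w" for x z v w
    proof -
      obtain t s where t: "t \<ge> 0" "p (x + t *\<^sub>R y) - t * p y \<le> v"
        and s: "s \<ge> 0" "p (z + s *\<^sub>R y) - s * p y \<le> w"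
        using \<open>P x v\<close> \<open>P z w\<close> by (auto simp: P_def)
      have "p (x + z + (t + s) *\<^sub>R y) \<le> p (x + t *\<^sub>R y) + p (z + s *\<^sub>R y)"
        using sublinear_add[OF p, of "x + t *\<^sub>R y" "z + s *\<^sub>R y"] by (simp add: algebra_simps)
      then show ?thesis
        unfolding P_def using t s by (intro exI[of _ "t + s"]) (simp add: algebra_simps)
    qed
    show "P (r *\<^sub>R x) (r * v)" if r: "r > 0" and "P x v" for r x v
    proof -
      obtain t where t: "t \<ge> 0" "p (x + t *\<^sub>R y) - t * p y \<le> v" using \<open>P x v\<close> by (auto simp: P_def)
      have "p (r *\<^sub>R x + (r * t) *\<^sub>R y) - r * t * p y = r * (p (x + t *\<^sub>R y) - t * p y)"
        using sublinear_scaleR[OF p, of r "x + t *\<^sub>R y"] r by (simp add: algebra_simps)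
      also have "\<dots> \<le> r * v" using t r by simp
      finally show ?thesis unfolding P_def using t r by (intro exI[of _ "r * t"]) simp
    qed
  qed (rule bound)
  then have "sublinear q" by (simp add: q_def[abs_def])
  moreover have lower: "q x \<le> v" if "P x v" for x v
    unfolding q_def using that by (intro cInf_lower bdd_belowI[of _ "- p (- x)"]) (auto dest: bound)
  have "q x \<le> p x" for x unfolding P_def by (rule lower) (auto simp: P_def intro!: exI[of _ 0])
  then have "q \<le> p" by (simp add: le_fun_def)
  moreover have "q (- y) \<le> - p y"
    by (rule lower) (auto simp: P_def sublinear_zero[OF p] intro!: exI[of _ 1])
  ultimately show thesis using that by blast
qed

text \<open>Minimality forces the directional modification to equal \<open>p\<close>, so
  \<open>p\<close> is odd, and an odd sublinear functional is linear.\<close>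

lemma minimal_sublinear_linear:
  assumes p: "sublinear p" and min: "\<And>q. sublinear q \<Longrightarrow> q \<le> p \<Longrightarrow> q = p"
  shows "linear p"
proof (rule linearI)
  have neg: "p (- y) = - p y" for y
  proof -
    obtain q where "sublinear q" "q \<le> p" "q (- y) \<le> - p y" using sublinear_directional[OF p] .
    then have "p (- y) \<le> - p y" using min by blast
    then show ?thesis using sublinear_minus[OF p, of y] by simp
  qed
  show "p (x + y) = p x + p y" for x y
    using sublinear_add[OF p, of x y] sublinear_add[OF p, of "- x" "- y"] neg[of "x + y"]
    by (simp add: neg)
  show "p (r *\<^sub>R x) = r *\<^sub>R p x" for r x
    using sublinear_scaleR[OF p, of r x] sublinear_scaleR[OF p, of "- r" "- x"]
    by (cases "r \<ge> 0") (simp_all add: neg)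
qed

text \<open>Hahn--Banach without partial functionals: a minimal sublinear functional is linear.\<close>

lemma linear_below_sublinear:
  fixes q :: "'v::real_vector \<Rightarrow> real"
  assumes q: "sublinear q"
  obtains f where "linear f" "f \<le> q"
proof -
  define A where "A = {p. sublinear p \<and> p \<le> q}"
  have "\<exists>m\<in>A. \<forall>p\<in>A. m \<ge> p \<longrightarrow> p = m"
  proof (rule predicate_Zorn)
    show "partial_order_on A (relation_of (\<ge>) A)"
      by (rule partial_order_on_relation_ofI) auto
  next
    fix C assume C: "C \<in> Chains (relation_of (\<ge>) A)"
    then have CA: "C \<subseteq> A" by (auto simp: Chains_def relation_of_def)
    have tot: "p \<le> p' \<or> p' \<le> p" if "p \<in> C" "p' \<in> C" for p p'
      using C that by (auto simp: Chains_def relation_of_def)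
    show "\<exists>u\<in>A. \<forall>p\<in>C. p \<ge> u"
    proof (cases "C = {}")
      case True
      then show ?thesis using q by (auto simp: A_def)
    next
      case False
      define P where "P x v \<longleftrightarrow> (\<exists>p\<in>C. p x \<le> v)" for x v
      define u where "u x = Inf {v. P x v}" for x
      have sub: "sublinear p" if "p \<in> C" for p using CA that by (auto simp: A_def)
      have bound: "- q (- x) \<le> v" if "P x v" for x v
      proof -
        obtain p where p: "p \<in> C" "p x \<le> v" using \<open>P x v\<close> by (auto simp: P_def)
        then have "p (- x) \<le> q (- x)" using CA by (auto simp: A_def le_fun_def)
        then show ?thesis using sublinear_minus[OF sub[OF p(1)], of x] p by simp
      qed
      have "sublinear (\<lambda>x. Inf {v. P x v})"
      proof (rule sublinear_Inf[where L = "\<lambda>x. - q (- x)"])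
        show "\<exists>v. P x v" for x using False by (auto simp: P_def)
        show "P 0 0" using False sublinear_zero[OF sub] by (metis P_def all_not_in_conv order_refl)
        show "P (r *\<^sub>R x) (r * v)" if "r > 0" "P x v" for r x v
        proof -
          obtain p where "p \<in> C" "p x \<le> v" using \<open>P x v\<close> by (auto simp: P_def)
          then show ?thesis
            using sublinear_scaleR[OF sub, of p r x] \<open>r > 0\<close> by (auto simp: P_def intro!: bexI[of _ p])
        qed
        show "P (x + y) (v + w)" if "P x v" "P y w" for x y v w
        proof -
          obtain p p' where p: "p \<in> C" "p x \<le> v" "p' \<in> C" "p' y \<le> w"
            using \<open>P x v\<close> \<open>P y w\<close> by (auto simp: P_def)
          \<comment> \<open>Two members of a chain are comparable, and the smaller one serves at
            both points.\<close>
          from tot[OF p(1,3)] obtain p'' where "p'' \<in> C" "p'' \<le> p" "p'' \<le> p'" using p by auto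
          then have "p'' \<in> C" "p'' x \<le> v" "p'' y \<le> w"
            using p by (auto simp: le_fun_def intro: order.trans)
          then show ?thesis
            unfolding P_def using sublinear_add[OF sub, of p'' x y] by (intro bexI[of _ p'']) auto
        qed
      qed (rule bound)
      then have "sublinear u" by (simp add: u_def[abs_def])
      moreover have below: "u \<le> p" if "p \<in> C" for p
      proof (rule le_funI)
        fix x
        have "P x (p x)" using that by (auto simp: P_def)
        then show "u x \<le> p x"
          unfolding u_def by (intro cInf_lower bdd_belowI[of _ "- q (- x)"]) (auto dest: bound)
      qed
      moreover obtain p where "p \<in> C" using False by blast
      then have "u \<le> q" using below[of p] CA by (auto simp: A_def)
      ultimately show ?thesis by (auto simp: A_def)
    qed
  qed
  then obtain m where m: "m \<in> A" "\<And>p. p \<in> A \<Longrightarrow> p \<le> m \<Longrightarrow> p = m" by blast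
  have "linear m"
    using m by (intro minimal_sublinear_linear) (auto simp: A_def)
  then show thesis using that m(1) by (auto simp: A_def)
qed

lemma linear_below_sublinear_attaining:
  fixes q :: "'v::real_vector \<Rightarrow> real"
  assumes q: "sublinear q"
  obtains f where "linear f" "f \<le> q" "f y = q y"
proof -
  obtain q' where q': "sublinear q'" "q' \<le> q" "q' (- y) \<le> - q y"
    using sublinear_directional[OF q] .
  obtain f where f: "linear f" "f \<le> q'" using linear_below_sublinear[OF q'(1)] .
  have "f (- y) \<le> - q y" using f(2) q'(3) by (metis le_funD order.trans)
  then have "q y \<le> f y" using linear_neg[OF f(1), of y] by simp
  moreover have "f \<le> q" using f(2) q'(2) by (rule order.trans)
  ultimately show thesis using that[OF f(1)] by (simp add: le_fun_def antisym)
qed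

lemma sublinear_infdist:
  fixes B :: "'v::real_normed_vector set"
  assumes B: "subspace B" shows "sublinear (\<lambda>x. infdist x B)"
proof -
  define P where "P x v \<longleftrightarrow> (\<exists>b\<in>B. dist x b \<le> v)" for x v
  have ne: "B \<noteq> {}" using subspace_0[OF B] by blast
  have "sublinear (\<lambda>x. Inf {v. P x v})"
  proof (rule sublinear_Inf[where L = "\<lambda>x. 0"])
    show "\<exists>v. P x v" for x using ne by (auto simp: P_def)
    show "0 \<le> v" if "P x v" for x v using that by (auto simp: P_def intro: order.trans[OF zero_le_dist])
    show "P 0 0" using subspace_0[OF B] by (auto simp: P_def intro!: bexI[of _ 0])
    show "P (r *\<^sub>R x) (r * v)" if "r > 0" "P x v" for r x v
    proof -
      obtain b where b: "b \<in> B" "dist x b \<le> v" using \<open>P x v\<close> by (auto simp: P_def)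
      have "dist (r *\<^sub>R x) (r *\<^sub>R b) = r * dist x b"
        using that(1) by (simp add: dist_norm flip: scaleR_right_diff_distrib)
      then show ?thesis using b that(1) subspace_scale[OF B b(1), of r]
        by (auto simp: P_def intro!: bexI[of _ "r *\<^sub>R b"])
    qed
    show "P (x + y) (v + w)" if "P x v" "P y w" for x y v w
    proof -
      obtain b c where "b \<in> B" "dist x b \<le> v" "c \<in> B" "dist y c \<le> w"
        using \<open>P x v\<close> \<open>P y w\<close> by (auto simp: P_def)
      then show ?thesis
        using subspace_add[OF B, of b c] dist_triangle_add[of x y b c]
        by (auto simp: P_def intro!: bexI[of _ "b + c"])
    qed
  qed
  moreover have "Inf {v. P x v} = infdist x B" for x
  proof (rule antisym)
    show "Inf {v. P x v} \<le> infdist x B"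
      unfolding infdist_notempty[OF ne]
    proof (rule cINF_greatest[OF ne])
      fix b assume "b \<in> B"
      then show "Inf {v. P x v} \<le> dist x b"
        by (intro cInf_lower bdd_belowI[of _ 0]) (auto simp: P_def intro: order.trans[OF zero_le_dist])
    qed
    show "infdist x B \<le> Inf {v. P x v}"
      using ne by (intro cInf_greatest) (auto simp: P_def intro: infdist_le2)
  qed
  ultimately show ?thesis by simp
qed

section \<open>Completion of a semi-inner product space\<close>

lemma nonneg_quadratic_discriminant:
  fixes a b c :: real
  assumes nonneg: "\<And>t. 0 \<le> a + 2 * b * t + c * t\<^sup>2" and c: "c \<ge> 0"
  shows "b\<^sup>2 \<le> a * c"
proof (cases "c = 0")
  case True
  have "b = 0"
  proof (rule ccontr)
    assume "b \<noteq> 0"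
    \<comment> \<open>The expression is affine in \<open>t\<close> here and takes the value -1 at
      this point.\<close>
    then show False using nonneg[of "- (a + 1) / (2 * b)"] True by simp
  qed
  then show ?thesis using True by simp
next
  case False
  have "0 \<le> a + 2 * b * (- b / c) + c * (- b / c)\<^sup>2" by (rule nonneg)
  also have "\<dots> = a - b\<^sup>2 / c" using False by (simp add: power2_eq_square field_simps)
  finally show ?thesis using False c by (simp add: field_simps)
qed

lemma (in vector_space_over) unimodular_scalar:
  assumes "z \<in> F"
  obtains \<omega> where "\<omega> \<in> F" "cmod \<omega> = 1" "\<omega> * z = complex_of_real (cmod z)"
proof (cases "z = 0")
  case True
  then show thesis using that[of 1] real_in_scalars[of 1] by simp
next
  case False
  have "cnj z / complex_of_real (cmod z) \<in> F"
    using scalars assms by (auto simp: Reals_cnj_iff)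
  moreover have "cnj z / complex_of_real (cmod z) * z = complex_of_real (cmod z)"
    using False complex_norm_square[of z] by (simp add: field_simps power2_eq_square)
  ultimately show thesis using that False by (simp add: norm_divide)
qed

lemma (in vector_space_over) cnj_mem: "c \<in> F \<Longrightarrow> cnj c \<in> F"
  and scalar_mult_mem: "c \<in> F \<Longrightarrow> d \<in> F \<Longrightarrow> c * d \<in> F"
  and scalar_add_mem: "c \<in> F \<Longrightarrow> d \<in> F \<Longrightarrow> c + d \<in> F"
  using scalars by (auto simp: Reals_cnj_iff)

lemma (in vector_space_over) closed_scalars: "closed F"
  using scalars by (auto simp: closed_complex_Reals)

locale semi_inner_product =
  vector_space_over F "UNIV :: 'v::ab_group_add set" scale
  for F :: "complex set" and scale :: "complex \<Rightarrow> 'v::ab_group_add \<Rightarrow> 'v" +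
  fixes form :: "'v \<Rightarrow> 'v \<Rightarrow> complex"
  assumes form_scalar: "form x y \<in> F"
    and form_add_right: "form x (y + z) = form x y + form x z"
    and form_scale_right: "c \<in> F \<Longrightarrow> form x (scale c y) = c * form x y"
    and form_cnj: "form y x = cnj (form x y)"
    and form_nonneg: "0 \<le> Re (form x x)"
begin

definition seminorm :: "'v \<Rightarrow> real" where
  "seminorm x = sqrt (Re (form x x))"

lemma seminorm_nonneg: "0 \<le> seminorm x"
  by (simp add: seminorm_def form_nonneg)

lemma seminorm_power2: "(seminorm x)\<^sup>2 = Re (form x x)"
  by (simp add: seminorm_def form_nonneg)

lemma form_self: "form x x = complex_of_real ((seminorm x)\<^sup>2)"
  using form_cnj[of x x] by (simp add: seminorm_power2 complex_eq_iff)

lemma form_add_left: "form (x + y) z = form x z + form y z"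
  using form_cnj[of "x + y" z] form_cnj[of x z] form_cnj[of y z] by (simp add: form_add_right)

lemma form_scale_left: "c \<in> F \<Longrightarrow> form (scale c x) y = cnj c * form x y"
  using form_cnj[of "scale c x" y] form_cnj[of x y] by (simp add: form_scale_right)

lemma form_minus_right: "form x (- y) = - form x y"
  using form_scale_right[of "-1" x y] scale_minus_one[of y] real_in_scalars[of "-1"] by simp

lemma form_diff_right: "form x (y - z) = form x y - form x z"
  using form_add_right[of x y "- z"] by (simp add: form_minus_right)

lemma seminorm_scale: "c \<in> F \<Longrightarrow> seminorm (scale c x) = cmod c * seminorm x"
proof -
  assume c: "c \<in> F"
  have "form (scale c x) (scale c x) = complex_of_real ((cmod c)\<^sup>2) * form x x"
    using c complex_norm_square[of c] by (simp add: form_scale_left form_scale_right)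
  then have "Re (form (scale c x) (scale c x)) = (cmod c)\<^sup>2 * Re (form x x)"
    by simp
  then show ?thesis by (simp add: seminorm_def real_sqrt_mult)
qed

lemma seminorm_square_add:
  "(seminorm (x + scale (complex_of_real t) y))\<^sup>2
    = (seminorm x)\<^sup>2 + 2 * t * Re (form y x) + (seminorm y)\<^sup>2 * t\<^sup>2"
proof -
  let ?t = "complex_of_real t"
  have "form (x + scale ?t y) (x + scale ?t y)
      = form x x + ?t * form y x + (?t * form x y + ?t * (?t * form y y))"
    unfolding form_add_left form_add_right form_scale_left[OF real_in_scalars]
      form_scale_right[OF real_in_scalars] complex_cnj_complex_of_real distrib_left ..
  then have "Re (form (x + scale ?t y) (x + scale ?t y))
      = Re (form x x) + t * Re (form y x) + (t * Re (form x y) + t * (t * Re (form y y)))"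
    by simp
  moreover have "Re (form x y) = Re (form y x)" by (subst form_cnj) simp
  ultimately show ?thesis by (simp add: seminorm_power2) (simp add: power2_eq_square algebra_simps)
qed

lemma semi_Cauchy_Schwarz: "cmod (form x y) \<le> seminorm x * seminorm y"
proof -
  obtain \<omega> where \<omega>: "\<omega> \<in> F" "cmod \<omega> = 1" "\<omega> * form x y = complex_of_real (cmod (form x y))"
    using unimodular_scalar[OF form_scalar] .
  let ?z = "scale \<omega> y"
  have Re: "Re (form ?z x) = cmod (form x y)"
    using form_cnj[of ?z x] \<omega> by (simp add: form_scale_right)
  have "(Re (form ?z x))\<^sup>2 \<le> (seminorm x)\<^sup>2 * (seminorm ?z)\<^sup>2"
  proof (rule nonneg_quadratic_discriminant)
    fix t
    have "0 \<le> (seminorm (x + scale (complex_of_real t) ?z))\<^sup>2" by simp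
    then show "0 \<le> (seminorm x)\<^sup>2 + 2 * Re (form ?z x) * t + (seminorm ?z)\<^sup>2 * t\<^sup>2"
      unfolding seminorm_square_add by (simp add: mult_ac)
  qed simp
  then have "(cmod (form x y))\<^sup>2 \<le> (seminorm x * seminorm y)\<^sup>2"
    using \<omega> by (simp add: Re seminorm_scale power_mult_distrib)
  then show ?thesis by (rule power2_le_imp_le) (simp add: seminorm_nonneg)
qed

text \<open>The completion is realised as the space of bounded antilinear functionals, in which \<open>x\<close>
  is represented by \<open>form _ x\<close>.\<close>

definition antidual :: "('v \<Rightarrow> complex) set" where
  "antidual = {f. (\<forall>x. f x \<in> F) \<and> (\<forall>x y. f (x + y) = f x + f y) \<and>
     (\<forall>c\<in>F. \<forall>x. f (scale c x) = cnj c * f x) \<and> (\<exists>K. \<forall>x. cmod (f x) \<le> K * seminorm x)}"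

lemma antidualI:
  assumes "\<And>x. f x \<in> F" "\<And>x y. f (x + y) = f x + f y"
    "\<And>c x. c \<in> F \<Longrightarrow> f (scale c x) = cnj c * f x" "\<And>x. cmod (f x) \<le> K * seminorm x"
  shows "f \<in> antidual"
  using assms unfolding antidual_def by auto

lemma antidual_scalar: "f \<in> antidual \<Longrightarrow> f x \<in> F"
  and antidual_add: "f \<in> antidual \<Longrightarrow> f (x + y) = f x + f y"
  and antidual_scale: "f \<in> antidual \<Longrightarrow> c \<in> F \<Longrightarrow> f (scale c x) = cnj c * f x"
  by (auto simp: antidual_def)

lemma antidual_diff: "f \<in> antidual \<Longrightarrow> f (x - y) = f x - f y"
  using antidual_add[of f "x - y" y] by simp

lemma antidual_bounded:
  assumes "f \<in> antidual"
  obtains K where "K \<ge> 0" "\<And>x. cmod (f x) \<le> K * seminorm x"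
proof -
  obtain K where K: "\<And>x. cmod (f x) \<le> K * seminorm x" using assms by (auto simp: antidual_def)
  have "cmod (f x) \<le> \<bar>K\<bar> * seminorm x" for x
    by (rule order.trans[OF K]) (simp add: mult_right_mono seminorm_nonneg)
  then show thesis using that[of "\<bar>K\<bar>"] by simp
qed

text \<open>Vectors of seminorm 0 are sent to 0, so this map also performs the quotient by the null
  space.\<close>

definition embed :: "'v \<Rightarrow> 'v \<Rightarrow> complex" where
  "embed x = (\<lambda>y. form y x)"

lemma embed_mem: "embed x \<in> antidual"
  by (rule antidualI[of _ "seminorm x"])
    (auto simp: embed_def form_scalar form_add_left form_scale_left semi_Cauchy_Schwarz mult.commute)

definition fscale :: "complex \<Rightarrow> ('v \<Rightarrow> complex) \<Rightarrow> 'v \<Rightarrow> complex" where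
  "fscale c f = (\<lambda>x. c * f x)"

text \<open>The dual norm of \<open>f - embed x\<close> is at most \<open>e\<close>, stated
  pointwise because the norm of the completion is only constructed from these
  approximations.\<close>

definition approx :: "('v \<Rightarrow> complex) \<Rightarrow> 'v \<Rightarrow> real \<Rightarrow> bool" where
  "approx f x e \<longleftrightarrow> (\<forall>y. cmod (f y - form y x) \<le> e * seminorm y)"

lemma approxD: "approx f x e \<Longrightarrow> cmod (f y - form y x) \<le> e * seminorm y"
  by (simp add: approx_def)

text \<open>A near minimiser \<open>x\<close> of \<open>\<parallel>x\<parallel>\<^sup>2 - 2 Re (f x)\<close> nearly represents \<open>f\<close>.\<close>

lemma approx_exists:
  assumes f: "f \<in> antidual" and e: "e > 0"
  shows "\<exists>x. approx f x e"
proof -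
  define J where "J x = (seminorm x)\<^sup>2 - 2 * Re (f x)" for x
  obtain K where K: "K \<ge> 0" "\<And>x. cmod (f x) \<le> K * seminorm x" using antidual_bounded[OF f] by blast
  have J_lower: "- K\<^sup>2 \<le> J x" for x
  proof -
    have "Re (f x) \<le> K * seminorm x" using complex_Re_le_cmod[of "f x"] K(2)[of x] by simp
    moreover have "0 \<le> (seminorm x - K)\<^sup>2" by simp
    ultimately show ?thesis unfolding J_def by (simp add: power2_diff algebra_simps)
  qed
  then have bdd: "bdd_below (range J)" by (intro bdd_belowI[of _ "- K\<^sup>2"]) auto
  \<comment> \<open>A slack of \<open>e\<^sup>2\<close> in the minimum becomes an error of
    \<open>e\<close>: along any line through \<open>x\<close> the quadratic \<open>J\<close> plus
    the slack stays nonnegative, which bounds its linear coefficient through the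
    discriminant.\<close>
  have "Inf (range J) < Inf (range J) + e\<^sup>2" using e by simp
  then have "\<exists>z\<in>range J. z < Inf (range J) + e\<^sup>2" by (subst (asm) cInf_less_iff) (use bdd in auto)
  then obtain x where x: "J x < Inf (range J) + e\<^sup>2" by blast
  have near: "J x - e\<^sup>2 \<le> J y" for y
    using cInf_lower[OF rangeI bdd, of y] x by linarith
  have "cmod (f y - form y x) \<le> e * seminorm y" for y
  proof -
    have "f y - form y x \<in> F"
      using scalars antidual_scalar[OF f, of y] form_scalar[of y x] by auto
    then obtain \<omega> where \<omega>: "\<omega> \<in> F" "cmod \<omega> = 1"
      "\<omega> * (f y - form y x) = complex_of_real (cmod (f y - form y x))"
      using unimodular_scalar by blast
    define z where "z = scale (cnj \<omega>) y"
    have \<omega>': "cnj \<omega> \<in> F" using cnj_mem[OF \<omega>(1)] .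
    have "f z - form z x = \<omega> * (f y - form y x)"
      by (simp add: z_def antidual_scale[OF f \<omega>'] form_scale_left[OF \<omega>'] right_diff_distrib)
    then have Re: "Re (f z) - Re (form z x) = cmod (f y - form y x)"
      using \<omega>(3) by (metis Re_complex_of_real minus_complex.sel(1))
    have "(Re (form z x) - Re (f z))\<^sup>2 \<le> e\<^sup>2 * (seminorm z)\<^sup>2"
    proof (rule nonneg_quadratic_discriminant)
      fix t
      have "f (x + scale (complex_of_real t) z) = f x + complex_of_real t * f z"
        using real_in_scalars[of t] by (simp add: antidual_add[OF f] antidual_scale[OF f])
      then have "J (x + scale (complex_of_real t) z)
          = J x + 2 * t * (Re (form z x) - Re (f z)) + (seminorm z)\<^sup>2 * t\<^sup>2"
        unfolding J_def seminorm_square_add by (simp add: algebra_simps)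
      then show "0 \<le> e\<^sup>2 + 2 * (Re (form z x) - Re (f z)) * t + (seminorm z)\<^sup>2 * t\<^sup>2"
        using near[of "x + scale (complex_of_real t) z"] by (simp add: mult_ac)
    qed simp
    moreover have "(Re (form z x) - Re (f z))\<^sup>2 = (cmod (f y - form y x))\<^sup>2"
      using Re by (metis power2_commute)
    moreover have "seminorm z = seminorm y"
      using \<omega>(2) by (simp add: z_def seminorm_scale[OF \<omega>'])
    ultimately have "(cmod (f y - form y x))\<^sup>2 \<le> (e * seminorm y)\<^sup>2"
      by (simp add: power_mult_distrib)
    then show ?thesis
      by (rule power2_le_imp_le) (use e seminorm_nonneg in simp)
  qed
  then show ?thesis unfolding approx_def by blast
qed

definition approximant :: "('v \<Rightarrow> complex) \<Rightarrow> nat \<Rightarrow> 'v" where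
  "approximant f n = (SOME x. approx f x (inverse (real (Suc n))))"

lemma approx_approximant: "f \<in> antidual \<Longrightarrow> approx f (approximant f n) (inverse (real (Suc n)))"
  unfolding approximant_def by (rule someI_ex, rule approx_exists) simp_all

lemma seminorm_diff_approx:
  assumes "approx f x d" "approx f y e" "d \<ge> 0" "e \<ge> 0"
  shows "seminorm (x - y) \<le> d + e"
proof (cases "seminorm (x - y) = 0")
  case False
  let ?z = "x - y"
  have pos: "seminorm ?z > 0" using False seminorm_nonneg[of ?z] by simp
  have "(seminorm ?z)\<^sup>2 = cmod (form ?z x - form ?z y)"
    using form_self[of ?z] by (simp add: form_diff_right[symmetric] norm_power)
  also have "\<dots> \<le> cmod (f ?z - form ?z y) + cmod (f ?z - form ?z x)"
    using norm_triangle_ineq4[of "f ?z - form ?z y" "f ?z - form ?z x"] by simp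
  also have "\<dots> \<le> (d + e) * seminorm ?z"
    using approxD[OF assms(1), of ?z] approxD[OF assms(2), of ?z] by (simp add: distrib_right)
  finally show ?thesis using pos by (simp add: power2_eq_square)
qed (use assms in simp)

lemma seminorm_approx_le:
  assumes "\<And>x. cmod (f x) \<le> K * seminorm x" "approx f x e" "K \<ge> 0" "e \<ge> 0"
  shows "seminorm x \<le> K + e"
proof (cases "seminorm x = 0")
  case False
  have "(seminorm x)\<^sup>2 = cmod (form x x)" using form_self[of x] by (simp add: norm_power)
  also have "\<dots> \<le> cmod (f x) + cmod (f x - form x x)"
    using norm_triangle_ineq4[of "f x" "f x - form x x"] by simp
  also have "\<dots> \<le> (K + e) * seminorm x"
    using assms(1)[of x] approxD[OF assms(2), of x] by (simp add: distrib_right)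
  finally show ?thesis using False seminorm_nonneg[of x] by (simp add: power2_eq_square)
qed (use assms in simp)

text \<open>Forced by continuity: the product of \<open>embed x\<close> with \<open>g\<close> has to
  be \<open>g x\<close>.\<close>

definition fip :: "('v \<Rightarrow> complex) \<Rightarrow> ('v \<Rightarrow> complex) \<Rightarrow> complex" where
  "fip f g = lim (\<lambda>n. g (approximant f n))"

text \<open>Independence of the chosen approximants. This freedom computes products with
  \<open>embed x\<close>, which \<open>x\<close> approximates with error 0, and moves operators
  across the inner product.\<close>

lemma fip_tendsto:
  assumes f: "f \<in> antidual" and g: "g \<in> antidual"
    and x: "\<And>n. approx f (x n) (e n)" and e: "\<And>n. e n \<ge> 0" "e \<longlonglongrightarrow> 0"
  shows "(\<lambda>n. g (x n)) \<longlonglongrightarrow> fip f g"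
proof -
  define r where "r = approximant f"
  define d where "d n = inverse (real (Suc n))" for n
  have r: "approx f (r n) (d n)" for n using approx_approximant[OF f] by (simp add: r_def d_def)
  have d: "d n \<ge> 0" "d \<longlonglongrightarrow> 0" for n
    using LIMSEQ_inverse_real_of_nat by (simp_all add: d_def[abs_def])
  obtain K where K: "K \<ge> 0" "\<And>x. cmod (g x) \<le> K * seminorm x" using antidual_bounded[OF g] by blast
  have diff: "cmod (g y - g z) \<le> K * (s + t)"
    if "approx f y s" "approx f z t" "s \<ge> 0" "t \<ge> 0" for y z s t
  proof -
    have "cmod (g y - g z) \<le> K * seminorm (y - z)" using K(2)[of "y - z"] by (simp add: antidual_diff[OF g])
    also have "\<dots> \<le> K * (s + t)" using seminorm_diff_approx[OF that] K(1) by (rule mult_left_mono)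
    finally show ?thesis .
  qed
  have "Cauchy (\<lambda>n. g (r n))"
  proof (rule CauchyI)
    fix \<epsilon> :: real assume \<epsilon>: "\<epsilon> > 0"
    have "(\<lambda>n. K * d n) \<longlonglongrightarrow> K * 0" using d by (intro tendsto_intros)
    then have "\<forall>\<^sub>F n in sequentially. K * d n < \<epsilon> / 2" using \<epsilon> by (intro order_tendstoD) auto
    then obtain N where N: "\<And>n. n \<ge> N \<Longrightarrow> K * d n < \<epsilon> / 2" by (auto simp: eventually_sequentially)
    have "norm (g (r m) - g (r n)) < \<epsilon>" if "m \<ge> N" "n \<ge> N" for m n
      using diff[OF r[of m] r[of n] d(1) d(1)] N[OF that(1)] N[OF that(2)]
      by (simp add: distrib_left)
    then show "\<exists>N. \<forall>m\<ge>N. \<forall>n\<ge>N. norm (g (r m) - g (r n)) < \<epsilon>" by blast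
  qed
  then have lim: "(\<lambda>n. g (r n)) \<longlonglongrightarrow> fip f g"
    unfolding fip_def r_def by (simp add: Cauchy_convergent_iff convergent_LIMSEQ_iff)
  have "(\<lambda>n. K * (e n + d n)) \<longlonglongrightarrow> K * (0 + 0)" using d e by (intro tendsto_intros)
  then have "(\<lambda>n. g (x n) - g (r n)) \<longlonglongrightarrow> 0"
    by (intro Lim_null_comparison[OF always_eventually[OF allI[OF diff[OF x r e(1) d(1)]]]]) simp
  from tendsto_add[OF this lim] show ?thesis by simp
qed

lemma fip_approximant_tendsto:
  "f \<in> antidual \<Longrightarrow> g \<in> antidual \<Longrightarrow> (\<lambda>n. g (approximant f n)) \<longlonglongrightarrow> fip f g"
  by (rule fip_tendsto[OF _ _ approx_approximant _ LIMSEQ_inverse_real_of_nat]) auto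

lemma approx_embed: "approx (embed x) x 0"
  by (simp add: approx_def embed_def)

lemma fip_embed_left: "g \<in> antidual \<Longrightarrow> fip (embed x) g = g x"
  using fip_tendsto[OF embed_mem _ approx_embed, of g x] by (simp add: LIMSEQ_const_iff)

lemma antidual_subspace: "subspace_over F fscale antidual"
  unfolding subspace_over_def
proof (intro conjI ballI)
  show "0 \<in> antidual"
    by (rule antidualI[of _ 0]) (use real_in_scalars[of 0] in auto)
  fix f assume f: "f \<in> antidual"
  obtain K where K: "K \<ge> 0" "\<And>x. cmod (f x) \<le> K * seminorm x" using antidual_bounded[OF f] by blast
  {
    fix g assume g: "g \<in> antidual"
    obtain L where L: "L \<ge> 0" "\<And>x. cmod (g x) \<le> L * seminorm x" using antidual_bounded[OF g] by blast
    show "f + g \<in> antidual"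
    proof (rule antidualI[of _ "K + L"])
      show "cmod ((f + g) x) \<le> (K + L) * seminorm x" for x
        using norm_triangle_mono[OF K(2)[of x] L(2)[of x]] by (simp add: distrib_right)
    qed (simp_all add: antidual_add f g antidual_scale antidual_scalar scalar_add_mem algebra_simps)
  }
  {
    fix c assume c: "c \<in> F"
    show "fscale c f \<in> antidual"
    proof (rule antidualI[of _ "cmod c * K"])
      show "cmod (fscale c f x) \<le> cmod c * K * seminorm x" for x
        using K(2)[of x] by (simp add: fscale_def norm_mult mult.assoc mult_left_mono)
    qed (simp_all add: fscale_def antidual_add f c antidual_scale antidual_scalar scalar_mult_mem algebra_simps)
  }
qed

text \<open>With approximants x of \<open>f\<close> and y of \<open>g\<close>, both f(y) and the
  conjugate of g(x) are close to the form of y and x; the errors vanish since the approximants have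
  bounded seminorm.\<close>

lemma fip_cnj:
  assumes f: "f \<in> antidual" and g: "g \<in> antidual"
  shows "fip g f = cnj (fip f g)"
proof -
  define x y where "x = approximant f" and "y = approximant g"
  define d where "d n = inverse (real (Suc n))" for n
  have x: "approx f (x n) (d n)" and y: "approx g (y n) (d n)" for n
    using approx_approximant f g by (simp_all add: x_def y_def d_def)
  have d: "d n \<ge> 0" "d n \<le> 1" "d \<longlonglongrightarrow> 0" for n
    using LIMSEQ_inverse_real_of_nat by (simp_all add: d_def[abs_def] field_simps)
  obtain K where K: "K \<ge> 0" "\<And>x. cmod (f x) \<le> K * seminorm x" using antidual_bounded[OF f] by blast
  obtain L where L: "L \<ge> 0" "\<And>x. cmod (g x) \<le> L * seminorm x" using antidual_bounded[OF g] by blast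
  have bound: "cmod (f (y n) - cnj (g (x n))) \<le> d n * (K + L + 2)" for n
  proof -
    have px: "seminorm (x n) \<le> K + 1"
      using seminorm_approx_le[OF K(2) x K(1) d(1), of n] d(2)[of n] by simp
    have py: "seminorm (y n) \<le> L + 1"
      using seminorm_approx_le[OF L(2) y L(1) d(1), of n] d(2)[of n] by simp
    have "cmod (cnj (g (x n)) - form (y n) (x n)) = cmod (g (x n) - form (x n) (y n))"
      using form_cnj[of "y n" "x n"] by (metis complex_cnj_diff complex_mod_cnj)
    then have "cmod (f (y n) - cnj (g (x n))) \<le> d n * seminorm (y n) + d n * seminorm (x n)"
      using norm_triangle_ineq4[of "f (y n) - form (y n) (x n)" "cnj (g (x n)) - form (y n) (x n)"]
        approxD[OF x, of "y n" n] approxD[OF y, of "x n" n] by simp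
    also have "\<dots> \<le> d n * (L + 1) + d n * (K + 1)"
      using px py d(1) by (intro add_mono mult_left_mono)
    finally show ?thesis by (simp add: algebra_simps)
  qed
  have "(\<lambda>n. d n * (K + L + 2)) \<longlonglongrightarrow> 0 * (K + L + 2)" using d(3) by (intro tendsto_intros)
  then have "(\<lambda>n. f (y n) - cnj (g (x n))) \<longlonglongrightarrow> 0"
    by (intro Lim_null_comparison[OF always_eventually[OF allI[OF bound]]]) simp
  moreover have "(\<lambda>n. f (y n) - cnj (g (x n))) \<longlonglongrightarrow> fip g f - cnj (fip f g)"
    unfolding x_def y_def by (intro tendsto_intros fip_approximant_tendsto f g)
  ultimately have "fip g f - cnj (fip f g) = 0" by (rule LIMSEQ_unique[symmetric])
  then show ?thesis by simp
qed

text \<open>The inequality for the form, passed to the limit along approximants of \<open>f\<close>.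
  It precedes the inner product structure and yields its definiteness: a nonzero value
  \<open>f y\<close> makes \<open>fip f f\<close> positive.\<close>

lemma antidual_Cauchy_Schwarz:
  assumes f: "f \<in> antidual"
  shows "(cmod (f y))\<^sup>2 \<le> (seminorm y)\<^sup>2 * Re (fip f f)"
proof -
  define x where "x = approximant f"
  define d where "d n = inverse (real (Suc n))" for n
  have x: "approx f (x n) (d n)" for n using approx_approximant[OF f] by (simp add: x_def d_def)
  have d: "d n \<ge> 0" "d n \<le> 1" "d \<longlonglongrightarrow> 0" for n
    using LIMSEQ_inverse_real_of_nat by (simp_all add: d_def[abs_def] field_simps)
  obtain K where K: "K \<ge> 0" "\<And>x. cmod (f x) \<le> K * seminorm x" using antidual_bounded[OF f] by blast
  define M where "M = K + 1"
  have M: "seminorm (x n) \<le> M" for n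
    using seminorm_approx_le[OF K(2) x K(1) d(1), of n] d(2)[of n] by (simp add: M_def)
  have bound: "(cmod (f y))\<^sup>2 \<le> (seminorm y)\<^sup>2 * (Re (f (x n)) + 3 * d n * M + (d n)\<^sup>2)" for n
  proof -
    have "(seminorm (x n))\<^sup>2 \<le> Re (f (x n)) + d n * seminorm (x n)"
      using approxD[OF x, of "x n" n] form_self[of "x n"] abs_Re_le_cmod[of "f (x n) - form (x n) (x n)"]
      by simp
    also have "\<dots> \<le> Re (f (x n)) + d n * M" using M[of n] d(1)[of n] by (simp add: mult_left_mono)
    finally have sq: "(seminorm (x n))\<^sup>2 \<le> Re (f (x n)) + d n * M" .
    have "cmod (f y) \<le> cmod (form y (x n)) + d n * seminorm y"
      using approxD[OF x, of y n] norm_triangle_ineq[of "f y - form y (x n)" "form y (x n)"] by simp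
    also have "\<dots> \<le> seminorm y * (seminorm (x n) + d n)"
      using semi_Cauchy_Schwarz[of y "x n"] by (simp add: algebra_simps)
    finally have "(cmod (f y))\<^sup>2 \<le> (seminorm y * (seminorm (x n) + d n))\<^sup>2" by (rule power_mono) simp
    also have "\<dots> = (seminorm y)\<^sup>2 * ((seminorm (x n))\<^sup>2 + 2 * d n * seminorm (x n) + (d n)\<^sup>2)"
      by (simp add: power2_eq_square algebra_simps)
    also have "\<dots> \<le> (seminorm y)\<^sup>2 * ((Re (f (x n)) + d n * M) + 2 * d n * M + (d n)\<^sup>2)"
      using sq M[of n] d(1)[of n] by (intro mult_left_mono add_mono) auto
    finally show ?thesis by (simp add: algebra_simps)
  qed
  have "(\<lambda>n. (seminorm y)\<^sup>2 * (Re (f (x n)) + 3 * d n * M + (d n)\<^sup>2))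
      \<longlonglongrightarrow> (seminorm y)\<^sup>2 * (Re (fip f f) + 3 * 0 * M + 0\<^sup>2)"
    unfolding x_def by (intro tendsto_intros fip_approximant_tendsto f d(3))
  then have "(cmod (f y))\<^sup>2 \<le> (seminorm y)\<^sup>2 * (Re (fip f f) + 3 * 0 * M + 0\<^sup>2)"
    by (rule LIMSEQ_le_const) (use bound in blast)
  then show ?thesis by simp
qed

sublocale completion: inner_product_space F antidual fscale fip
proof
  show "F = \<real> \<or> F = UNIV" by (rule scalars)
  show "subspace_over F fscale antidual" by (rule antidual_subspace)
  fix f g h assume f: "f \<in> antidual" and g: "g \<in> antidual"
  show "fip f g \<in> F"
    by (rule closed_sequentially[OF closed_scalars _ fip_approximant_tendsto[OF f g]])
      (rule antidual_scalar[OF g])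
  show "fip g f = cnj (fip f g)" by (rule fip_cnj[OF f g])
  show "fip f (fscale c g) = c * fip f g" if c: "c \<in> F" for c
  proof (rule LIMSEQ_unique)
    have "fscale c g \<in> antidual" using antidual_subspace c g by (simp add: subspace_over_def)
    then show "(\<lambda>n. fscale c g (approximant f n)) \<longlonglongrightarrow> fip f (fscale c g)"
      by (rule fip_approximant_tendsto[OF f])
    show "(\<lambda>n. fscale c g (approximant f n)) \<longlonglongrightarrow> c * fip f g"
      unfolding fscale_def by (intro tendsto_intros fip_approximant_tendsto f g)
  qed
  {
    assume h: "h \<in> antidual"
    show "fip f (g + h) = fip f g + fip f h"
    proof (rule LIMSEQ_unique)
      have "g + h \<in> antidual" using antidual_subspace g h by (simp add: subspace_over_def)
      then show "(\<lambda>n. (g + h) (approximant f n)) \<longlonglongrightarrow> fip f (g + h)"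
        by (rule fip_approximant_tendsto[OF f])
      show "(\<lambda>n. (g + h) (approximant f n)) \<longlonglongrightarrow> fip f g + fip f h"
        unfolding plus_fun_apply by (intro tendsto_intros fip_approximant_tendsto f g h)
    qed
  }
next
  fix f assume f: "f \<in> antidual" "f \<noteq> 0"
  then obtain y where "f y \<noteq> 0" by (auto simp: fun_eq_iff)
  then have "0 < (seminorm y)\<^sup>2 * Re (fip f f)"
    using antidual_Cauchy_Schwarz[OF f(1), of y]
    by (metis norm_eq_zero order.strict_trans2 zero_less_power2)
  then show "0 < Re (fip f f)" by (simp add: zero_less_mult_iff)
qed (auto simp: fscale_def fun_eq_iff algebra_simps)

section \<open>The Hilbert norm as a dual norm, completeness and density\<close>

lemma antidual_le_hnorm:
  assumes "f \<in> antidual" shows "cmod (f y) \<le> completion.hnorm f * seminorm y"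
proof (rule power2_le_imp_le)
  show "(cmod (f y))\<^sup>2 \<le> (completion.hnorm f * seminorm y)\<^sup>2"
    using antidual_Cauchy_Schwarz[OF assms, of y] completion.hnorm_power2[OF assms]
    by (simp add: power_mult_distrib mult.commute)
qed (simp add: completion.hnorm_ge_0[OF assms] seminorm_nonneg)

text \<open>The squared norm is the limit of f(x) along approximants x, whose seminorms are at most
  \<open>K\<close> up to a vanishing error. With \<open>antidual_le_hnorm\<close> this identifies
  the Hilbert norm with the dual norm.\<close>

lemma hnorm_le:
  assumes f: "f \<in> antidual" and K: "K \<ge> 0" "\<And>y. cmod (f y) \<le> K * seminorm y"
  shows "completion.hnorm f \<le> K"
proof (rule power2_le_imp_le[OF _ K(1)])
  define x where "x = approximant f"
  define d where "d n = inverse (real (Suc n))" for n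
  have x: "approx f (x n) (d n)" for n using approx_approximant[OF f] by (simp add: x_def d_def)
  have d: "d n \<ge> 0" "d \<longlonglongrightarrow> 0" for n
    using LIMSEQ_inverse_real_of_nat by (simp_all add: d_def[abs_def])
  have "Re (f (x n)) \<le> K * (K + d n)" for n
  proof -
    have "Re (f (x n)) \<le> K * seminorm (x n)"
      using K(2)[of "x n"] complex_Re_le_cmod[of "f (x n)"] by simp
    also have "\<dots> \<le> K * (K + d n)"
      by (rule mult_left_mono[OF seminorm_approx_le[OF K(2) x K(1) d(1)] K(1)])
    finally show ?thesis .
  qed
  moreover have "(\<lambda>n. Re (f (x n))) \<longlonglongrightarrow> Re (fip f f)"
    unfolding x_def by (intro tendsto_intros fip_approximant_tendsto f)
  moreover have "(\<lambda>n. K * (K + d n)) \<longlonglongrightarrow> K * (K + 0)" by (intro tendsto_intros d)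
  ultimately have "Re (fip f f) \<le> K * (K + 0)" by (blast intro: LIMSEQ_le)
  then show "(completion.hnorm f)\<^sup>2 \<le> K\<^sup>2"
    unfolding completion.hnorm_power2[OF f] by (simp add: power2_eq_square)
qed

lemma hdist_le:
  assumes "f \<in> antidual" "g \<in> antidual" "K \<ge> 0" "\<And>y. cmod (f y - g y) \<le> K * seminorm y"
  shows "completion.hdist f g \<le> K"
  using hnorm_le[OF completion.diff_mem[OF assms(1,2)] assms(3)] assms
  by (simp add: completion.hdist_def)

lemma diff_le_hdist:
  assumes "f \<in> antidual" "g \<in> antidual"
  shows "cmod (f y - g y) \<le> completion.hdist f g * seminorm y"
  using antidual_le_hnorm[OF completion.diff_mem[OF assms], of y] assms
  by (simp add: completion.hdist_def)

text \<open>Because the distance is a dual norm, a Cauchy sequence converges pointwise and its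
  uniform estimates pass to the limit.\<close>

lemma completion_mcomplete: "completion.mcomplete"
  unfolding completion.mcomplete_def
proof (intro allI impI)
  fix \<sigma> assume C: "completion.MCauchy \<sigma>"
  then have mem: "\<sigma> n \<in> antidual" for n by (auto simp: completion.MCauchy_def)
  have small: "\<exists>N. \<forall>m n. N \<le> m \<longrightarrow> N \<le> n \<longrightarrow> completion.hdist (\<sigma> m) (\<sigma> n) < e" if "e > 0" for e
    using C that by (simp add: completion.MCauchy_def)
  have "Cauchy (\<lambda>n. \<sigma> n y)" for y
  proof (rule CauchyI)
    fix e :: real assume e: "e > 0"
    define s where "s = seminorm y + 1"
    have s: "s > 0" "seminorm y \<le> s" using seminorm_nonneg[of y] by (auto simp: s_def)
    obtain N where N: "\<And>m n. m \<ge> N \<Longrightarrow> n \<ge> N \<Longrightarrow> completion.hdist (\<sigma> m) (\<sigma> n) < e / s"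
      using small[of "e / s"] e s by auto
    have "norm (\<sigma> m y - \<sigma> n y) < e" if "m \<ge> N" "n \<ge> N" for m n
    proof -
      have "norm (\<sigma> m y - \<sigma> n y) \<le> completion.hdist (\<sigma> m) (\<sigma> n) * s"
        using diff_le_hdist[OF mem mem, of m y n] mult_left_mono[OF s(2), of "completion.hdist (\<sigma> m) (\<sigma> n)"]
        by simp
      also have "\<dots> < e" using N[OF that] s(1) by (simp add: field_simps)
      finally show ?thesis .
    qed
    then show "\<exists>N. \<forall>m\<ge>N. \<forall>n\<ge>N. norm (\<sigma> m y - \<sigma> n y) < e" by blast
  qed
  then have "\<exists>z. (\<lambda>n. \<sigma> n y) \<longlonglongrightarrow> z" for y
    by (simp add: Cauchy_convergent_iff convergent_def)
  then obtain f where lim: "\<And>y. (\<lambda>n. \<sigma> n y) \<longlonglongrightarrow> f y" by metis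
  have close: "cmod (\<sigma> n y - f y) \<le> e * seminorm y"
    if N: "\<forall>m n. N \<le> m \<longrightarrow> N \<le> n \<longrightarrow> completion.hdist (\<sigma> m) (\<sigma> n) < e" and n: "n \<ge> N" for N e n y
  proof (rule LIMSEQ_le_const2)
    show "(\<lambda>m. cmod (\<sigma> n y - \<sigma> m y)) \<longlonglongrightarrow> cmod (\<sigma> n y - f y)" by (intro tendsto_intros lim)
    have "cmod (\<sigma> n y - \<sigma> m y) \<le> e * seminorm y" if "m \<ge> N" for m
      using diff_le_hdist[OF mem mem, of n y m] N n that seminorm_nonneg[of y]
      by (meson less_imp_le mult_right_mono order.trans)
    then show "\<exists>N. \<forall>m\<ge>N. cmod (\<sigma> n y - \<sigma> m y) \<le> e * seminorm y" by blast
  qed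
  have f: "f \<in> antidual"
  proof -
    obtain N where N: "\<forall>m n. N \<le> m \<longrightarrow> N \<le> n \<longrightarrow> completion.hdist (\<sigma> m) (\<sigma> n) < 1"
      using small[of 1] by auto
    show ?thesis
    proof (rule antidualI)
      show "f x \<in> F" for x
        by (rule closed_sequentially[OF closed_scalars _ lim]) (rule antidual_scalar[OF mem])
      show "f (x + y) = f x + f y" for x y
        using tendsto_add[OF lim[of x] lim[of y]] lim[of "x + y"]
        by (simp add: antidual_add[OF mem]) (metis LIMSEQ_unique)
      show "f (scale c x) = cnj c * f x" if "c \<in> F" for c x
        using tendsto_mult_left[OF lim[of x], of "cnj c"] lim[of "scale c x"]
        by (simp add: antidual_scale[OF mem that]) (metis LIMSEQ_unique)
      show "cmod (f y) \<le> (completion.hnorm (\<sigma> N) + 1) * seminorm y" for y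
      proof -
        have "cmod (\<sigma> N y - f y) \<le> 1 * seminorm y" by (rule close[OF N order_refl])
        then show ?thesis
          using antidual_le_hnorm[OF mem, of N y] norm_triangle_ineq4[of "\<sigma> N y" "\<sigma> N y - f y"]
          by (simp add: distrib_right)
      qed
    qed
  qed
  have "\<exists>N. \<forall>n\<ge>N. \<sigma> n \<in> antidual \<and> completion.hdist (\<sigma> n) f < e" if e: "e > 0" for e
  proof -
    obtain N where N: "\<forall>m n. N \<le> m \<longrightarrow> N \<le> n \<longrightarrow> completion.hdist (\<sigma> m) (\<sigma> n) < e / 2"
      using small[of "e / 2"] e by auto
    have "completion.hdist (\<sigma> n) f \<le> e / 2" if "n \<ge> N" for n
      using e by (intro hdist_le mem f close[OF N that]) auto
    then show ?thesis using mem e by (intro exI[of _ N]) force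
  qed
  then show "\<exists>f. limitin completion.mtopology \<sigma> f sequentially"
    using f by (auto simp: completion.limit_metric_sequentially)
qed

sublocale completion: hilbert_space F antidual fscale fip
  by unfold_locales (rule completion_mcomplete)

lemma hnorm_embed: "completion.hnorm (embed x) = seminorm x"
  unfolding completion.hnorm_def by (simp add: fip_embed_left embed_mem) (simp add: embed_def seminorm_def)

lemma embed_dense: "completion.mtopology closure_of (range embed) = antidual"
proof
  show "completion.mtopology closure_of (range embed) \<subseteq> antidual"
    using closure_of_subset_topspace[of completion.mtopology] by simp
  show "antidual \<subseteq> completion.mtopology closure_of (range embed)"
  proof
    fix f assume f: "f \<in> antidual"
    have "\<exists>x. embed x \<in> completion.mball f r" if r: "r > 0" for r
    proof -
      obtain x where "approx f x (r / 2)" using approx_exists[OF f, of "r / 2"] r by auto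
      then have "completion.hdist f (embed x) \<le> r / 2"
        using r by (intro hdist_le f embed_mem) (auto simp: approx_def embed_def)
      then show ?thesis
        using f embed_mem r by (intro exI[of _ x]) (simp add: completion.in_mball)
    qed
    then show "f \<in> completion.mtopology closure_of (range embed)"
      using f unfolding completion.metric_closure_of by auto
  qed
qed

end

section \<open>States\<close>

lemma linear_below_infdist:
  fixes f :: "'v::real_normed_vector \<Rightarrow> real"
  assumes B: "subspace B" and f: "linear f" "\<And>x. f x \<le> infdist x B" and b: "b \<in> B"
  shows "f b = 0"
  using f(2)[of b] f(2)[of "- b"] b subspace_neg[OF B b] linear_neg[OF f(1), of b] by simp

context unital_cstar_algebra
begin

text \<open>Operator convexity with its exact defect, the last term, which is positive for
  nonnegative weights.\<close>

lemma convex_combination_star_mult: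
  assumes "a + b = (1::real)"
  shows "a *\<^sub>R (star w * w) + b *\<^sub>R (star v * v)
    = star (a *\<^sub>R w + b *\<^sub>R v) * (a *\<^sub>R w + b *\<^sub>R v) + (a * b) *\<^sub>R (star (w - v) * (w - v))"
proof -
  have b: "b = 1 - a" using assms by simp
  show ?thesis unfolding b by (simp add: star_add star_diff star_scaleR algebra_simps)
qed

lemma norm_scaled_star_mult_plus_positive:
  assumes "r \<ge> 0" "positive k" "1 \<le> norm w"
  shows "r \<le> norm (r *\<^sub>R (star w * w) + k)"
proof -
  have "r * 1 \<le> r * (norm w)\<^sup>2" using assms by (intro mult_left_mono) auto
  also have "\<dots> = norm (r *\<^sub>R (star w * w))" using assms(1) by (simp add: cstar_identity)
  also have "\<dots> \<le> norm (r *\<^sub>R (star w * w) + k)"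
    by (intro norm_positive_mono positive_scaleR positive_star_mult assms)
  finally show ?thesis by simp
qed

text \<open>A positive functional \<open>\<phi>\<close> with \<open>\<phi>(w\<^sup>* w) \<ge> 1\<close> whenever \<open>\<psi> w = 1\<close> is obtained below the
  sublinear functional \<open>y \<mapsto> inf (\<parallel>y + r w\<^sup>* w + k\<parallel> - r)\<close>. The infimum is finite because the norm is
  monotone on positive elements and \<open>\<psi> w = 1\<close> forces \<open>\<parallel>w\<parallel> \<ge> 1\<close>; it is subadditive because
  \<open>w \<mapsto> w\<^sup>* w\<close> is operator convex.\<close>

lemma dominating_positive_functional:
  assumes \<psi>: "linear \<psi>" "\<And>x. \<psi> x \<le> norm x" and w0: "\<psi> w0 = (1::real)"
  obtains \<phi> where "linear \<phi>" "\<And>x. \<phi> x \<le> norm x" "\<And>k. positive k \<Longrightarrow> 0 \<le> \<phi> k"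
    "\<And>x. (\<psi> x)\<^sup>2 \<le> \<phi> (star x * x)"
proof -
  define P where "P y v \<longleftrightarrow> (\<exists>r w k. r \<ge> 0 \<and> \<psi> w = 1 \<and> positive k \<and>
    norm (y + r *\<^sub>R (star w * w) + k) - r \<le> v)" for y v
  have PI: "P y v" if "r \<ge> 0" "\<psi> w = 1" "positive k" "norm (y + r *\<^sub>R (star w * w) + k) - r \<le> v"
    for y v r w k
    using that unfolding P_def by blast
  have bound: "- norm y \<le> v" if "P y v" for y v
  proof -
    obtain r w k where rwk: "r \<ge> 0" "\<psi> w = 1" "positive k"
      "norm (y + r *\<^sub>R (star w * w) + k) - r \<le> v"
      using \<open>P y v\<close> unfolding P_def by blast
    have "1 \<le> norm w" using \<psi>(2)[of w] rwk(2) by simp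
    then have "r \<le> norm (r *\<^sub>R (star w * w) + k)"
      by (rule norm_scaled_star_mult_plus_positive[OF rwk(1,3)])
    also have "\<dots> \<le> norm (y + r *\<^sub>R (star w * w) + k) + norm y"
      using norm_triangle_ineq4[of "y + r *\<^sub>R (star w * w) + k" y] by (simp add: add.assoc)
    finally show ?thesis using rwk(4) by simp
  qed
  have "sublinear (\<lambda>y. Inf {v. P y v})"
  proof (rule sublinear_Inf[where L = "\<lambda>y. - norm y"])
    show "\<exists>v. P y v" for y using PI[of 0 w0 0 y] w0 positive_zero by auto
    show "P 0 0" using PI[of 0 w0 0 0] w0 positive_zero by simp
    show "P (c *\<^sub>R y) (c * v)" if c: "c > 0" and "P y v" for c y v
    proof -
      obtain r w k where rwk: "r \<ge> 0" "\<psi> w = 1" "positive k"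
        "norm (y + r *\<^sub>R (star w * w) + k) - r \<le> v"
        using \<open>P y v\<close> unfolding P_def by blast
      have "c *\<^sub>R y + (c * r) *\<^sub>R (star w * w) + c *\<^sub>R k = c *\<^sub>R (y + r *\<^sub>R (star w * w) + k)"
        by (simp add: scaleR_add_right)
      then have "norm (c *\<^sub>R y + (c * r) *\<^sub>R (star w * w) + c *\<^sub>R k) - c * r
          = c * (norm (y + r *\<^sub>R (star w * w) + k) - r)"
        using c by (simp add: right_diff_distrib)
      also have "\<dots> \<le> c * v" using rwk(4) c by simp
      finally show ?thesis
        using c rwk by (intro PI[of "c * r" w "c *\<^sub>R k"]) (auto intro: positive_scaleR)
    qed
    show "P (y + z) (v + u)" if "P y v" "P z u" for y z v u
    proof -
      obtain r w k where 1: "r \<ge> 0" "\<psi> w = 1" "positive k"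
        "norm (y + r *\<^sub>R (star w * w) + k) - r \<le> v"
        using \<open>P y v\<close> unfolding P_def by blast
      obtain s x l where 2: "s \<ge> 0" "\<psi> x = 1" "positive l"
        "norm (z + s *\<^sub>R (star x * x) + l) - s \<le> u"
        using \<open>P z u\<close> unfolding P_def by blast
      have sum: "norm (y + z + (r *\<^sub>R (star w * w) + s *\<^sub>R (star x * x)) + (k + l)) - (r + s) \<le> v + u"
        using norm_triangle_ineq[of "y + r *\<^sub>R (star w * w) + k" "z + s *\<^sub>R (star x * x) + l"] 1(4) 2(4)
        by (simp add: algebra_simps)
      show ?thesis
      proof (cases "r + s = 0")
        case True
        then have "r = 0" "s = 0" using 1 2 by auto
        then show ?thesis
          using sum 1 2 by (intro PI[of 0 w "k + l"]) (auto intro: positive_add)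
      next
        case False
        \<comment> \<open>The convex combination \<open>t\<close> still satisfies
          \<open>\<psi> t = 1\<close>, and the positive defect \<open>d\<close> is absorbed into the
          slack \<open>k + l\<close>.\<close>
        define a b where "a = r / (r + s)" and "b = s / (r + s)"
        have ab: "a + b = 1" "a \<ge> 0" "b \<ge> 0" "r = (r + s) * a" "s = (r + s) * b"
          using False 1(1) 2(1) by (auto simp: a_def b_def simp flip: add_divide_distrib)
        define t where "t = a *\<^sub>R w + b *\<^sub>R x"
        define d where "d = ((r + s) * (a * b)) *\<^sub>R (star (w - x) * (w - x))"
        have "r *\<^sub>R (star w * w) + s *\<^sub>R (star x * x)
            = (r + s) *\<^sub>R (a *\<^sub>R (star w * w) + b *\<^sub>R (star x * x))"
          unfolding scaleR_add_right scaleR_scaleR ab(4,5)[symmetric] ..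
        also have "\<dots> = (r + s) *\<^sub>R (star t * t) + d"
          unfolding convex_combination_star_mult[OF ab(1)] t_def d_def by (simp only: scaleR_add_right scaleR_scaleR)
        finally have "norm (y + z + (r + s) *\<^sub>R (star t * t) + (d + (k + l))) - (r + s) \<le> v + u"
          using sum by (simp add: add.assoc)
        moreover have "positive (d + (k + l))"
          unfolding d_def using 1 2 ab by (intro positive_add positive_scaleR positive_star_mult) auto
        moreover have "\<psi> t = 1"
          using ab(1) by (simp add: t_def linear_add[OF \<psi>(1)] linear_scale[OF \<psi>(1)] 1 2)
        ultimately show ?thesis using 1(1) 2(1) by (intro PI[of "r + s" t "d + (k + l)"]) auto
      qed
    qed
  qed (rule bound)
  then obtain \<phi> where \<phi>: "linear \<phi>" "\<phi> \<le> (\<lambda>y. Inf {v. P y v})"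
    using linear_below_sublinear by blast
  have below: "\<phi> y \<le> v" if "P y v" for y v
  proof -
    have "Inf {v. P y v} \<le> v"
      using that by (intro cInf_lower bdd_belowI[of _ "- norm y"]) (auto dest: bound)
    then show ?thesis using \<phi>(2) by (auto simp: le_fun_def intro: order.trans)
  qed
  have pos: "0 \<le> \<phi> k" if "positive k" for k
    using below[OF PI[of 0 w0 k "- k" 0]] w0 that linear_neg[OF \<phi>(1), of k] by simp
  \<comment> \<open>At \<open>- (star w * w)\<close> with \<open>r = 1\<close> the norm vanishes and
    the value is -1; positivity was the same test at \<open>- k\<close> with
    \<open>r = 0\<close>.\<close>
  have one: "1 \<le> \<phi> (star w * w)" if "\<psi> w = 1" for w
    using below[OF PI[of 1 w 0 "- (star w * w)" "-1"]] that positive_zero linear_neg[OF \<phi>(1)] by simp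
  have "(\<psi> x)\<^sup>2 \<le> \<phi> (star x * x)" for x
  proof (cases "\<psi> x = 0")
    case True
    then show ?thesis using pos[OF positive_star_mult] by simp
  next
    case False
    have "1 \<le> \<phi> (star (inverse (\<psi> x) *\<^sub>R x) * (inverse (\<psi> x) *\<^sub>R x))"
      using False by (intro one) (simp add: linear_scale[OF \<psi>(1)])
    then have "1 \<le> inverse ((\<psi> x)\<^sup>2) * \<phi> (star x * x)"
      by (simp add: star_scaleR linear_scale[OF \<phi>(1)] power2_eq_square)
    then show ?thesis using False by (simp add: field_simps)
  qed
  then show thesis
    using below PI[of 0 w0 0] w0 positive_zero pos by (intro that[OF \<phi>(1)]) auto
qed

text \<open>Averaging with the adjoint changes nothing on self-adjoint elements, where positivity
  and domination are tested. Then \<phi>(1) \<le> 1 by the norm bound, and \<open>star x * x\<close>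
  being below the square of \<open>norm x\<close> bounds \<psi> by sqrt(\<phi>(1)) times the norm,
  so \<open>sup\<close> gives \<phi>(1) \<ge> 1.\<close>

lemma dominating_state:
  assumes \<psi>: "linear \<psi>" "\<And>x. \<psi> x \<le> norm x"
    and sup: "\<And>M. M \<ge> 0 \<Longrightarrow> (\<And>x. \<psi> x \<le> M * norm x) \<Longrightarrow> 1 \<le> M"
  obtains \<phi> where "linear \<phi>" "\<And>k. positive k \<Longrightarrow> 0 \<le> \<phi> k"
    "\<And>x. (\<psi> x)\<^sup>2 \<le> \<phi> (star x * x)" "\<And>x. \<phi> (star x) = \<phi> x" "\<phi> 1 = (1::real)"
proof -
  obtain x where "\<psi> x \<noteq> 0" using sup[of 0] by force
  then have "\<psi> (inverse (\<psi> x) *\<^sub>R x) = 1" by (simp add: linear_scale[OF \<psi>(1)])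
  from dominating_positive_functional[OF \<psi> this] obtain \<phi>0 where
    \<phi>0: "linear \<phi>0" "\<And>x. \<phi>0 x \<le> norm x" "\<And>k. positive k \<Longrightarrow> 0 \<le> \<phi>0 k"
      "\<And>x. (\<psi> x)\<^sup>2 \<le> \<phi>0 (star x * x)" by blast
  define \<phi> where "\<phi> x = (\<phi>0 x + \<phi>0 (star x)) / 2" for x
  have lin: "linear \<phi>"
    by (rule linearI)
      (auto simp: \<phi>_def star_add star_scaleR linear_add[OF \<phi>0(1)] linear_scale[OF \<phi>0(1)] field_simps)
  have sa: "\<phi> x = \<phi>0 x" if "star x = x" for x using that by (simp add: \<phi>_def)
  have pos: "0 \<le> \<phi> k" if "positive k" for k
    using that \<phi>0(3) positive_selfadjoint by (simp add: sa)
  have dom: "(\<psi> x)\<^sup>2 \<le> \<phi> (star x * x)" for x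
    using \<phi>0(4) by (simp add: sa star_mult star_star)
  have "\<phi> 1 \<le> 1" using \<phi>0(2)[of 1] by (simp add: sa star_one)
  moreover have "1 \<le> sqrt (\<phi> 1)"
  proof (rule sup)
    have "positive 1" using positive_star_mult[of 1] by (simp add: star_one)
    then show "0 \<le> sqrt (\<phi> 1)" using pos by simp
    fix x
    have "positive ((norm x)\<^sup>2 *\<^sub>R 1 - star x * x)"
      by (rule positive_scalar_minus) (simp_all add: star_mult star_star cstar_identity)
    from pos[OF this] have "\<phi> (star x * x) \<le> (norm x)\<^sup>2 * \<phi> 1"
      by (simp add: linear_diff[OF lin] linear_scale[OF lin])
    then have "(\<psi> x)\<^sup>2 \<le> (norm x)\<^sup>2 * \<phi> 1" using dom[of x] by simp
    then have "sqrt ((\<psi> x)\<^sup>2) \<le> sqrt ((norm x)\<^sup>2 * \<phi> 1)" by (rule real_sqrt_le_mono)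
    then show "\<psi> x \<le> sqrt (\<phi> 1) * norm x" by (simp add: real_sqrt_mult mult.commute)
  qed
  ultimately have "\<phi> 1 = 1" by simp
  moreover have "\<phi> (star x) = \<phi> x" for x by (simp add: \<phi>_def star_star)
  ultimately show thesis using that lin pos dom by blast
qed

text \<open>The \<open>F\<close>-linear functional with real part \<open>f\<close>.\<close>

definition linear_extension :: "('a \<Rightarrow> real) \<Rightarrow> 'a \<Rightarrow> complex" where
  "linear_extension f x = Complex (f x) (if F = \<real> then 0 else - f (scale \<i> x))"

lemma Re_linear_extension [simp]: "Re (linear_extension f x) = f x"
  by (simp add: linear_extension_def)

lemma linear_extension_mem: "linear_extension f x \<in> F"
  using scalars by (auto simp: linear_extension_def complex_is_Real_iff)

context
  fixes f :: "'a \<Rightarrow> real"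
  assumes f: "linear f"
begin

lemma linear_extension_add: "linear_extension f (x + y) = linear_extension f x + linear_extension f y"
  using scalars
  by (auto simp: linear_extension_def complex_eq_iff linear_add[OF f] scale_add_right)

lemma linear_extension_scale:
  assumes c: "c \<in> F" shows "linear_extension f (scale c x) = c * linear_extension f x"
proof (cases "F = \<real>")
  case True
  then obtain r where c': "c = complex_of_real r" using c by (auto elim: Reals_cases)
  show ?thesis
    unfolding linear_extension_def c' scale_of_real linear_scale[OF f]
    using True by (simp add: complex_eq_iff)
next
  case False
  then have F: "c \<in> F" for c using scalars by auto
  have eq: "scale c x = Re c *\<^sub>R x + Im c *\<^sub>R scale \<i> x" for c x
  proof -
    have "c = complex_of_real (Re c) + complex_of_real (Im c) * \<i>" by (simp add: complex_eq_iff)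
    then have "scale c x = scale (complex_of_real (Re c) + complex_of_real (Im c) * \<i>) x" by simp
    also have "\<dots> = scale (complex_of_real (Re c)) x + scale (complex_of_real (Im c)) (scale \<i> x)"
      using scale_add_left[OF F F, of x] scale_scale[OF F F, of x] by simp
    finally show ?thesis by (simp only: scale_of_real)
  qed
  have f_scale: "f (scale c x) = Re c * f x + Im c * f (scale \<i> x)" for c
    by (subst eq) (simp add: linear_add[OF f] linear_scale[OF f])
  have f_i: "f (scale \<i> (scale c x)) = Re c * f (scale \<i> x) - Im c * f x"
    using scale_scale[OF F F, of x \<i> c] f_scale[of "\<i> * c"] by simp
  show ?thesis
    unfolding linear_extension_def using False f_scale[of c] f_i by (simp add: complex_eq_iff algebra_simps)
qed

lemma norm_linear_extension_le:
  assumes le: "\<And>x. f x \<le> N x" and N: "\<And>c x. c \<in> F \<Longrightarrow> cmod c = 1 \<Longrightarrow> N (scale c x) = N x"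
  shows "cmod (linear_extension f x) \<le> N x"
proof -
  obtain \<omega> where \<omega>: "\<omega> \<in> F" "cmod \<omega> = 1"
    "\<omega> * linear_extension f x = complex_of_real (cmod (linear_extension f x))"
    using unimodular_scalar[OF linear_extension_mem] .
  have "cmod (linear_extension f x) = Re (linear_extension f (scale \<omega> x))"
    using \<omega> by (simp only: linear_extension_scale Re_complex_of_real)
  also have "\<dots> = f (scale \<omega> x)" by simp
  also have "\<dots> \<le> N x" using le[of "scale \<omega> x"] N[OF \<omega>(1,2)] by simp
  finally show ?thesis .
qed

end

end

section \<open>The representation of a state\<close>

text \<open>Here \<phi> is the real part of the state. Positivity constrains only self-adjoint
  elements, so invariance under \<open>star\<close> is demanded separately; it makes the form
  hermitian.\<close>

locale cstar_state = unital_cstar_algebra F scale star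
  for F :: "complex set"
    and scale :: "complex \<Rightarrow> 'a::{real_normed_algebra_1, banach} \<Rightarrow> 'a"
    and star :: "'a \<Rightarrow> 'a" +
  fixes \<phi> :: "'a \<Rightarrow> real"
  assumes state_linear: "linear \<phi>"
    and state_positive: "positive k \<Longrightarrow> 0 \<le> \<phi> k"
    and state_star: "\<phi> (star x) = \<phi> x"
    and state_one: "\<phi> 1 = 1"
begin

lemma linear_extension_star: "linear_extension \<phi> (star x) = cnj (linear_extension \<phi> x)"
proof (cases "F = \<real>")
  case True
  then show ?thesis unfolding linear_extension_def by (simp add: state_star complex_eq_iff)
next
  case False
  then have F: "c \<in> F" for c using scalars by auto
  have "scale \<i> (star x) = star (scale (- \<i>) x)" using star_scale[OF F, of "- \<i>" x] by simp
  also have "scale (- \<i>) x = - scale \<i> x"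
    using scale_scale[OF F F, of x "-1" \<i>] scale_minus_one[of "scale \<i> x"] by simp
  finally have "\<phi> (scale \<i> (star x)) = - \<phi> (scale \<i> x)"
    by (simp add: state_star linear_neg[OF state_linear])
  then show ?thesis
    using False by (simp add: linear_extension_def state_star complex_eq_iff)
qed

sublocale semi_inner_product F scale "\<lambda>x y. linear_extension \<phi> (star x * y)"
proof
  show "linear_extension \<phi> (star y * x) = cnj (linear_extension \<phi> (star x * y))" for x y
    using linear_extension_star[of "star x * y"] by (simp add: star_mult star_star)
qed (simp_all add: linear_extension_mem distrib_left linear_extension_add[OF state_linear]
    scale_mult_right linear_extension_scale[OF state_linear] state_positive positive_star_mult)

lemma seminorm_square: "(seminorm x)\<^sup>2 = \<phi> (star x * x)"
  by (simp add: seminorm_power2)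

text \<open>Conjugating the positive element
  \<open>(norm x)\<^sup>2 *\<^sub>R 1 - star x * x\<close> by \<open>y\<close> and applying \<phi>.
  This is the boundedness of left multiplication.\<close>

lemma seminorm_mult_le: "seminorm (x * y) \<le> norm x * seminorm y"
proof (rule power2_le_imp_le)
  have "positive ((norm x)\<^sup>2 *\<^sub>R 1 - star x * x)"
    by (rule positive_scalar_minus) (simp_all add: star_mult star_star cstar_identity)
  from state_positive[OF positive_conjugate[OF this, of y]]
  have "\<phi> (star y * (star x * x) * y) \<le> (norm x)\<^sup>2 * \<phi> (star y * y)"
    by (simp add: algebra_simps linear_diff[OF state_linear] linear_scale[OF state_linear])
  then show "(seminorm (x * y))\<^sup>2 \<le> (norm x * seminorm y)\<^sup>2"
    by (simp add: seminorm_square power_mult_distrib star_mult mult.assoc)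
qed (simp add: seminorm_nonneg)

lemma seminorm_le_norm: "seminorm x \<le> norm x"
proof -
  have "(seminorm 1)\<^sup>2 = 1" by (simp add: seminorm_square star_one state_one)
  then have "seminorm 1 = 1" using seminorm_nonneg[of 1] by (simp add: power2_eq_1_iff)
  then show ?thesis using seminorm_mult_le[of x 1] by simp
qed

text \<open>Left multiplication by \<open>x\<close>, moved to the other argument of the form: it
  sends \<open>embed z\<close> to \<open>embed (x * z)\<close> and makes sense on every
  functional.\<close>

definition rep :: "'a \<Rightarrow> ('a \<Rightarrow> complex) \<Rightarrow> 'a \<Rightarrow> complex" where
  "rep x f = (\<lambda>y. f (star x * y))"

lemma rep_bound:
  assumes "f \<in> antidual"
  shows "cmod (rep x f y) \<le> norm x * completion.hnorm f * seminorm y"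
proof -
  have "cmod (rep x f y) \<le> completion.hnorm f * seminorm (star x * y)"
    unfolding rep_def by (rule antidual_le_hnorm[OF assms])
  also have "\<dots> \<le> completion.hnorm f * (norm x * seminorm y)"
    using seminorm_mult_le[of "star x" y] completion.hnorm_ge_0[OF assms]
    by (intro mult_left_mono) (simp_all add: norm_star)
  finally show ?thesis by (simp add: mult_ac)
qed

lemma rep_mem:
  assumes "f \<in> antidual" shows "rep x f \<in> antidual"
proof (rule antidualI)
  show "cmod (rep x f y) \<le> norm x * completion.hnorm f * seminorm y" for y
    by (rule rep_bound[OF assms])
qed (simp_all add: rep_def distrib_left scale_mult_right antidual_scalar[OF assms]
    antidual_add[OF assms] antidual_scale[OF assms])

lemma rep_embed_one: "rep x (embed 1) = embed x"
  by (simp add: rep_def embed_def star_mult star_star)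

text \<open>Multiplying approximants of \<open>f\<close> by \<open>star x\<close> approximates
  \<open>rep (star x) f\<close>, so both sides are limits of one sequence.\<close>

lemma fip_rep_star:
  assumes f: "f \<in> antidual" and g: "g \<in> antidual"
  shows "fip (rep (star x) f) g = fip f (rep x g)"
proof (rule LIMSEQ_unique)
  let ?d = "\<lambda>n. inverse (real (Suc n))"
  have "approx (rep (star x) f) (star x * approximant f n) (norm x * ?d n)" for n
    unfolding approx_def
  proof
    fix y
    have "cmod (rep (star x) f y - linear_extension \<phi> (star y * (star x * approximant f n)))
        \<le> ?d n * seminorm (x * y)"
      using approxD[OF approx_approximant[OF f], of "x * y" n]
      by (simp add: rep_def star_mult star_star mult.assoc)
    also have "\<dots> \<le> ?d n * (norm x * seminorm y)"
      by (intro mult_left_mono seminorm_mult_le) simp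
    finally show "cmod (rep (star x) f y - linear_extension \<phi> (star y * (star x * approximant f n)))
        \<le> norm x * ?d n * seminorm y" by (simp only: mult_ac)
  qed
  moreover have "(\<lambda>n. norm x * ?d n) \<longlonglongrightarrow> 0"
    using tendsto_mult_left[OF LIMSEQ_inverse_real_of_nat, of "norm x"] by simp
  ultimately show "(\<lambda>n. g (star x * approximant f n)) \<longlonglongrightarrow> fip (rep (star x) f) g"
    by (intro fip_tendsto[OF rep_mem[OF f] g]) auto
  show "(\<lambda>n. g (star x * approximant f n)) \<longlonglongrightarrow> fip f (rep x g)"
    using fip_approximant_tendsto[OF f rep_mem[OF g], of x] by (simp add: rep_def)
qed

lemma cyclic_representation: "cyclic_representation F scale star antidual fscale fip rep (embed 1)"
proof
  show "completion.bounded_operator (rep x)" for x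
    unfolding completion.bounded_operator_def
  proof (intro conjI ballI exI)
    fix f assume f: "f \<in> antidual"
    show "completion.hnorm (rep x f) \<le> norm x * completion.hnorm f"
      by (rule hnorm_le[OF rep_mem[OF f] _ rep_bound[OF f]])
        (simp add: completion.hnorm_ge_0[OF f])
  qed (auto simp: rep_mem[unfolded rep_def] rep_def fscale_def fun_eq_iff)
  show "completion.mtopology closure_of (range (\<lambda>x. rep x (embed 1))) = antidual"
    using embed_dense by (simp add: rep_embed_one)
  show "completion.hnorm (embed 1) = 1"
    by (simp add: hnorm_embed seminorm_def star_one state_one)
  show "embed 1 \<in> antidual" by (rule embed_mem)
  show "fip (rep (star x) f) g = fip f (rep x g)" if "f \<in> antidual" "g \<in> antidual" for x f g
    using that by (rule fip_rep_star)
qed (auto simp: rep_def fscale_def fun_eq_iff star_add star_scale star_mult star_one distrib_right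
    scale_mult_left antidual_add antidual_scale cnj_mem mult.assoc)

end

section \<open>The functional attaining the distance, and the conclusion\<close>

lemma (in unital_cstar_algebra) subspace_over_subspace:
  assumes "subspace_over F scale B" shows "subspace B"
  using assms real_in_scalars unfolding subspace_over_def subspace_def
  by (metis scale_of_real)

lemma (in unital_cstar_algebra) infdist_scale_le:
  assumes B: "subspace_over F scale B" and c: "c \<in> F" "cmod c = 1"
  shows "infdist (scale c x) B \<le> infdist x B"
proof -
  have ne: "B \<noteq> {}" using B by (auto simp: subspace_over_def)
  have "infdist (scale c x) B \<le> dist x b" if b: "b \<in> B" for b
  proof (rule infdist_le2)
    show "scale c b \<in> B" using B b c by (simp add: subspace_over_def)
    have "scale c x = scale c (x - b) + scale c b"
      using scale_add_right[OF c(1), of "x - b" b] by simp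
    then show "dist (scale c x) (scale c b) \<le> dist x b"
      using norm_scale[OF c(1), of "x - b"] c(2) by (simp add: dist_norm)
  qed
  then show ?thesis unfolding infdist_notempty[OF ne, of x] by (rule cINF_greatest[OF ne])
qed

lemma (in unital_cstar_algebra) infdist_scale:
  assumes B: "subspace_over F scale B" and c: "c \<in> F" "cmod c = 1"
  shows "infdist (scale c x) B = infdist x B"
proof (rule antisym[OF infdist_scale_le[OF assms]])
  have "cnj c * c = 1" using c(2) complex_norm_square[of c] by (simp add: mult.commute)
  then have "scale (cnj c) (scale c x) = x"
    using scale_scale[OF cnj_mem[OF c(1)] c(1), of x] scale_one[of x] by simp
  then show "infdist x B \<le> infdist (scale c x) B"
    using infdist_scale_le[OF B cnj_mem[OF c(1)], of "scale c x"] c(2) by simp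
qed

text \<open>If \<open>infdist a B = 0\<close>, the functional has to be taken from another element; this is where
  \<open>closure B \<noteq> UNIV\<close> enters.\<close>

lemma (in unital_cstar_algebra) norming_functional:
  assumes B: "subspace_over F scale B" and ne: "closure B \<noteq> UNIV"
  obtains \<psi> where "linear \<psi>" "\<And>x. \<psi> x \<le> infdist x B" "\<psi> a = infdist a B"
    "\<And>M. M \<ge> 0 \<Longrightarrow> (\<And>x. \<psi> x \<le> M * norm x) \<Longrightarrow> 1 \<le> M"
proof -
  have sub: "subspace B" by (rule subspace_over_subspace[OF B])
  have "B \<noteq> {}" using subspace_0[OF sub] by blast
  note zero_iff = in_closure_iff_infdist_zero[OF this]
  obtain a' where a': "infdist a' B > 0" "infdist a B > 0 \<Longrightarrow> a' = a"
  proof (cases "infdist a B > 0")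
    case False
    obtain y where "y \<notin> closure B" using ne by blast
    then have "infdist y B > 0" using zero_iff[of y] infdist_nonneg[of y B] by (simp add: less_le)
    then show thesis using that False by blast
  qed (use that in blast)
  obtain \<psi> where \<psi>: "linear \<psi>" "\<psi> \<le> (\<lambda>x. infdist x B)" "\<psi> a' = infdist a' B"
    using linear_below_sublinear_attaining[OF sublinear_infdist[OF sub]] .
  have le: "\<psi> x \<le> infdist x B" for x using \<psi>(2) by (simp add: le_fun_def)
  have "\<psi> a = infdist a B"
  proof (cases "infdist a B > 0")
    case True
    then show ?thesis using a' \<psi> by simp
  next
    case False
    then have 0: "infdist a B = 0" using infdist_nonneg[of a B] by linarith
    \<comment> \<open>Both \<open>a\<close> and \<open>- a\<close> have distance 0, so \<psi> is
      squeezed to 0 at \<open>a\<close>, whichever \<open>a'\<close> was taken.\<close>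
    then have "infdist (- a) B \<le> 0"
      using infdist_scale_le[OF B, of "-1" a] real_in_scalars[of "-1"] scale_minus_one[of a] by simp
    then show ?thesis using 0 le[of a] le[of "- a"] linear_neg[OF \<psi>(1), of a] by simp
  qed
  moreover have "1 \<le> M" if M: "M \<ge> 0" "\<And>x. \<psi> x \<le> M * norm x" for M
  proof (rule ccontr)
    assume "\<not> 1 \<le> M"
    \<comment> \<open>As \<psi> vanishes on \<open>B\<close>, its value at \<open>a' - b\<close> is
      the distance for every \<open>b\<close>; the infimum over \<open>b\<close> of the bound by
      \<open>M\<close> gives this, which is absurd for \<open>M < 1\<close>.\<close>
    have "infdist a' B \<le> M * infdist a' B"
    proof (cases "M = 0")
      case True
      then show ?thesis using M(2)[of a'] \<psi>(3) by simp
    next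
      case False
      have "infdist a' B / M \<le> infdist a' B"
        unfolding infdist_notempty[OF \<open>B \<noteq> {}\<close>, of a']
      proof (rule cINF_greatest[OF \<open>B \<noteq> {}\<close>], fold infdist_notempty[OF \<open>B \<noteq> {}\<close>])
        fix b assume b: "b \<in> B"
        have "infdist a' B = \<psi> (a' - b)"
          using linear_below_infdist[OF sub \<psi>(1) le b] \<psi>(3) by (simp add: linear_diff[OF \<psi>(1)])
        also have "\<dots> \<le> M * dist a' b" using M(2)[of "a' - b"] by (simp add: dist_norm)
        finally show "infdist a' B / M \<le> dist a' b" using M(1) False by (simp add: field_simps)
      qed
      then show ?thesis using M(1) False by (simp add: field_simps)
    qed
    then show False using a'(1) \<open>\<not> 1 \<le> M\<close> by simp
  qed
  ultimately show thesis using that \<psi>(1) le by blast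
qed

theorem theorem3p4:
  fixes F :: "complex set"
    and scale :: "complex \<Rightarrow> 'a::{real_normed_algebra_1, banach} \<Rightarrow> 'a"
    and star :: "'a \<Rightarrow> 'a"
    and a :: 'a
    and B :: "'a set"
  assumes "unital_cstar_algebra F scale star"
    and "subspace_over F scale B"
    and "closure B \<noteq> UNIV"
  shows "\<exists>(H :: ('a \<Rightarrow> complex) set) scl ip rep \<xi> \<eta>.
           cyclic_representation F scale star H scl ip rep \<xi> \<and>
           \<eta> \<in> H \<and> inner_product_space.hnorm ip \<eta> = 1 \<and>
           complex_of_real (infdist a B) = ip \<eta> (rep a \<xi>) \<and>
           (\<forall>b\<in>B. ip \<eta> (rep b \<xi>) = 0)"
proof -
  interpret A: unital_cstar_algebra F scale star by (rule assms(1))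
  note B = assms(2)
  obtain \<psi> where \<psi>: "linear \<psi>" "\<And>x. \<psi> x \<le> infdist x B" "\<psi> a = infdist a B"
    "\<And>M. M \<ge> 0 \<Longrightarrow> (\<And>x. \<psi> x \<le> M * norm x) \<Longrightarrow> 1 \<le> M"
    using A.norming_functional[OF B assms(3)] by metis
  have "infdist x B \<le> norm x" for x
    using infdist_le[of 0 B x] B by (simp add: subspace_over_def)
  then have \<psi>_norm: "\<psi> x \<le> norm x" for x using \<psi>(2) order.trans by blast
  obtain \<phi> where \<phi>: "linear \<phi>" "\<And>k. A.positive k \<Longrightarrow> 0 \<le> \<phi> k"
    "\<And>x. (\<psi> x)\<^sup>2 \<le> \<phi> (star x * x)" "\<And>x. \<phi> (star x) = \<phi> x" "\<phi> 1 = (1::real)"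
    using A.dominating_state[OF \<psi>(1) \<psi>_norm \<psi>(4)] by blast
  interpret S: cstar_state F scale star \<phi>
    by (intro cstar_state.intro assms(1) cstar_state_axioms.intro) (simp_all add: \<phi>)
  define \<Psi> where "\<Psi> = A.linear_extension \<psi>"
  \<comment> \<open>The Hilbert space consists of antilinear functionals, hence the conjugate;
    conjugate symmetry then turns the value of \<eta> at x back into
    \<open>\<Psi> x\<close>.\<close>
  define \<eta> where "\<eta> x = cnj (\<Psi> x)" for x
  have \<Psi>_dist: "cmod (\<Psi> x) \<le> infdist x B" for x
    unfolding \<Psi>_def by (rule A.norm_linear_extension_le[OF \<psi>(1,2) A.infdist_scale[OF B]])
  have "\<psi> x \<le> S.seminorm x" for x
    by (rule power2_le_imp_le) (simp_all add: S.seminorm_square \<phi>(3) S.seminorm_nonneg)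
  then have \<Psi>_seminorm: "cmod (\<Psi> x) \<le> S.seminorm x" for x
    unfolding \<Psi>_def by (rule A.norm_linear_extension_le[OF \<psi>(1)]) (simp add: S.seminorm_scale)
  have \<eta>: "\<eta> \<in> S.antidual"
    by (rule S.antidualI[of _ 1])
      (simp_all add: \<eta>_def \<Psi>_def A.cnj_mem A.linear_extension_mem A.linear_extension_add[OF \<psi>(1)]
        A.linear_extension_scale[OF \<psi>(1)] \<Psi>_seminorm[unfolded \<Psi>_def])
  have ip: "S.fip \<eta> (S.rep x (S.embed 1)) = \<Psi> x" for x
    using S.fip_cnj[OF S.embed_mem \<eta>, of x] S.fip_embed_left[OF \<eta>, of x]
    by (simp add: S.rep_embed_one \<eta>_def)
  have "S.completion.hnorm \<eta> \<le> 1"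
    by (rule S.hnorm_le[OF \<eta>]) (simp_all add: \<eta>_def \<Psi>_seminorm)
  moreover have "1 \<le> S.completion.hnorm \<eta>"
  proof (rule \<psi>(4))
    show pos: "0 \<le> S.completion.hnorm \<eta>" by (rule S.completion.hnorm_ge_0[OF \<eta>])
    fix x
    have "\<psi> x = Re (\<Psi> x)" by (simp add: \<Psi>_def)
    also have "\<dots> \<le> cmod (\<eta> x)" unfolding \<eta>_def using complex_Re_le_cmod[of "\<Psi> x"] by simp
    also have "\<dots> \<le> S.completion.hnorm \<eta> * S.seminorm x" by (rule S.antidual_le_hnorm[OF \<eta>])
    also have "\<dots> \<le> S.completion.hnorm \<eta> * norm x"
      by (rule mult_left_mono[OF S.seminorm_le_norm pos])
    finally show "\<psi> x \<le> S.completion.hnorm \<eta> * norm x" .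
  qed
  ultimately have unit: "S.completion.hnorm \<eta> = 1" by simp
  \<comment> \<open>The real part is already the distance and the modulus does not exceed it, which
    leaves no room for an imaginary part.\<close>
  have "\<Psi> a = complex_of_real (infdist a B)"
  proof -
    have Re: "Re (\<Psi> a) = infdist a B" by (simp add: \<Psi>_def \<psi>(3))
    then have "(cmod (\<Psi> a))\<^sup>2 \<le> (Re (\<Psi> a))\<^sup>2" using \<Psi>_dist[of a] by (simp add: power_mono)
    then have "Im (\<Psi> a) = 0" by (simp add: cmod_power2)
    then show ?thesis using Re by (simp add: complex_eq_iff)
  qed
  moreover have "\<Psi> b = 0" if "b \<in> B" for b
    using \<Psi>_dist[of b] that by simp
  ultimately show ?thesis
    using S.cyclic_representation \<eta> unit ip
    by (intro exI[of _ S.antidual] exI[of _ S.fscale] exI[of _ S.fip] exI[of _ S.rep]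
        exI[of _ "S.embed 1"] exI[of _ \<eta>]) simp
qed

end
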